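(* Let $\{\varphi_j\}_{j=0}^\infty$ be the orthonormal polynomials on the unit circle with respect to $\mu$, where $\mu$ is a strictly positive (probability) Borel measure on $[-\pi,\pi)$ (identified with $\mathbb{T}$), absolutely continuous with respect to Lebesgue measure, and regular in the sense of Stahl, Totik, and Ullman. Assume that $\mu$ has a positive weight function that is continuous on $\mathbb{T}$. Then for every $v\in\mathbb{C}$, $$\lim_{n\to\infty}\mathbb{E}\left[\frac1n\,N_{\mathbb{D}}^{\Phi_n,v}\right]=\frac12.$$
   Context: $\mathbb{D}$ is the open unit disk, $\mathbb{T}$ the unit circle. $\varphi_j$ has degree $j$ and positive leading coefficient $\kappa_j$, with $\int_{\mathbb{T}}\varphi_j(e^{i\theta})\overline{\varphi_k(e^{i\theta})}\,d\mu(e^{i\theta})=\delta_{jk}$, where $\mu$ is a probability Borel measure on $\mathbb{T}$ (so $\varphi_0=1$). $\mu$ is regular in the sense of Stahl, Totik, and Ullman if $\lim_{j\to\infty}\kappa_j^{1/j}=1$. The random polynomial is $\Phi_n(z)=\sum_{j=0}^n\eta_j\varphi_j(z)$, where $\eta_0,\eta_1,\dots$ are i.i.d. standard complex normal random variables (density $\frac1\pi e^{-|z|^2}$ on $\mathbb{C}$, mean $0$, $\mathbb{E}|\eta_j|^2=1$). $N_{\mathbb{D}}^{\Phi_n,v}$ is the (random) number of roots in $\mathbb{D}$, counted with multiplicity, of the equation $\Phi_n(z)=v$. *)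

theory Defs
  imports
    "HOL-Probability.Probability"
    "HOL-Computational_Algebra.Computational_Algebra"
begin

text \<open>Measures on the unit circle are represented as measures on the parameter interval
  from \<open>-pi\<close> (included) to \<open>pi\<close> (excluded); the parameter \<open>t\<close> stands for the point \<open>cis t\<close>.\<close>

definition borel_arc :: "real measure" where
  "borel_arc = restrict_space borel {-pi..<pi}"

definition lebesgue_arc :: "real measure" where
  "lebesgue_arc = restrict_space lborel {-pi..<pi}"

definition circle_prob_measure :: "real measure \<Rightarrow> bool" where
  "circle_prob_measure \<mu> \<longleftrightarrow> prob_space \<mu> \<and> sets \<mu> = sets borel_arc"

text \<open>Strict positivity refers to the topology of the circle, hence open subsets of the plane
  that meet the circle are pulled back along \<open>cis\<close>.\<close>

definition strictly_positive_measure :: "real measure \<Rightarrow> bool" where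
  "strictly_positive_measure \<mu> \<longleftrightarrow>
     (\<forall>U::complex set. open U \<longrightarrow> U \<inter> sphere 0 1 \<noteq> {} \<longrightarrow>
        emeasure \<mu> {t \<in> {-pi..<pi}. cis t \<in> U} > 0)"

text \<open>The weight is taken with respect to normalized arc length \<open>dt / (2 pi)\<close>.\<close>

definition has_weight :: "real measure \<Rightarrow> (complex \<Rightarrow> real) \<Rightarrow> bool" where
  "has_weight \<mu> w \<longleftrightarrow> \<mu> = density lebesgue_arc (\<lambda>t. ennreal (w (cis t) / (2 * pi)))"

definition kappa :: "(nat \<Rightarrow> complex poly) \<Rightarrow> nat \<Rightarrow> real" where
  "kappa \<phi> j = Re (lead_coeff (\<phi> j))"

definition orthonormal_polys :: "real measure \<Rightarrow> (nat \<Rightarrow> complex poly) \<Rightarrow> bool" where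
  "orthonormal_polys \<mu> \<phi> \<longleftrightarrow>
     (\<forall>j. degree (\<phi> j) = j \<and> lead_coeff (\<phi> j) \<in> \<real> \<and> kappa \<phi> j > 0) \<and>
     (\<forall>j k. (LINT t|\<mu>. poly (\<phi> j) (cis t) * cnj (poly (\<phi> k) (cis t)))
              = (if j = k then 1 else 0))"

text \<open>Stahl--Totik--Ullman regularity of a measure on the circle. The orthonormal polynomials
  are determined by the measure, so the quantifier ranges over at most one sequence.\<close>

definition stu_regular :: "real measure \<Rightarrow> bool" where
  "stu_regular \<mu> \<longleftrightarrow>
     (\<exists>\<phi>. orthonormal_polys \<mu> \<phi> \<and> (\<lambda>j. root j (kappa \<phi> j)) \<longlonglongrightarrow> 1)"

definition std_complex_normal_density :: "complex \<Rightarrow> ennreal" where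
  "std_complex_normal_density z = ennreal (exp (- (cmod z)\<^sup>2) / pi)"

definition iid_std_complex_normal :: "'a measure \<Rightarrow> (nat \<Rightarrow> 'a \<Rightarrow> complex) \<Rightarrow> bool" where
  "iid_std_complex_normal P \<eta> \<longleftrightarrow>
     prob_space.indep_vars P (\<lambda>_. borel) \<eta> UNIV \<and>
     (\<forall>j. distributed P lborel (\<eta> j) std_complex_normal_density)"

definition random_poly ::
  "(nat \<Rightarrow> complex poly) \<Rightarrow> (nat \<Rightarrow> 'a \<Rightarrow> complex) \<Rightarrow> nat \<Rightarrow> 'a \<Rightarrow> complex poly" where
  "random_poly \<phi> \<eta> n \<omega> = (\<Sum>j\<le>n. smult (\<eta> j \<omega>) (\<phi> j))"

text \<open>Number of solutions of \<open>p(z) = v\<close> in the open unit disk, with multiplicity.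
  If \<open>p\<close> is the constant \<open>v\<close>, the value is 0; for random polynomials this has probability 0.\<close>

definition disk_roots :: "complex poly \<Rightarrow> complex \<Rightarrow> nat" where
  "disk_roots p v = size {# z \<in># proots (p - [:v:]). z \<in> ball 0 1 #}"

end

theory Submission
  imports Defs "HOL-Complex_Analysis.Complex_Analysis"
begin

text \<open>Write \<open>a\<^sub>j = \<phi>\<^sub>j(z)\<close>, \<open>b\<^sub>j = z \<phi>\<^sub>j'(z)\<close> and \<open>K\<^sub>n(z) = \<Sum>\<^sub>j\<^sub>\<le>\<^sub>n \<bar>a\<^sub>j\<bar>\<^sup>2\<close>, and let \<open>\<Phi>\<^sub>n\<close> be the random
  polynomial. The proof rests on the identity
  \<open>E N = n/2 \<cdot> mean of P(\<bar>\<Phi>\<^sub>n(z)\<bar> > \<bar>v\<bar>) over \<bar>z\<bar> = 1\<close>, which holds for every \<open>n\<close> and \<open>v\<close>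
  (\<open>expectation_disk_roots\<close>). Since \<open>\<Phi>\<^sub>n(z)\<close> is a complex Gaussian of variance \<open>K\<^sub>n(z)\<close>, the theorem
  follows from it as soon as \<open>K\<^sub>n(z)\<close> tends to infinity at every point of the circle. That in turn
  holds because \<open>1/K\<^sub>n(z)\<close> is the least \<open>L\<^sup>2(\<mu>)\<close> norm squared of a polynomial of degree at most \<open>n\<close>
  with value 1 at \<open>z\<close>, and \<open>\<mu>\<close> has no atoms (\<open>kernel_at_top\<close>).

  The identity combines three facts. If no root of \<open>\<Phi>\<^sub>n = v\<close> lies on a circle around 0,
  then by the argument principle the number of roots inside is the mean over the circle of
  \<open>Re (z \<Phi>\<^sub>n'(z) / (\<Phi>\<^sub>n(z) - v))\<close>. The \<open>L\<^sup>1\<close> norm of this function on a circle is at most \<open>n\<close>, whatever the roots are, because the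
  contribution of each root is one half plus half a Poisson kernel up to sign. Expectation and circle
  mean may therefore be exchanged.

  Secondly, for fixed \<open>z\<close>, the expectation of \<open>z \<Phi>\<^sub>n'(z) / (\<Phi>\<^sub>n(z) - v)\<close> is
  \<open>(\<Sum> b\<^sub>j cnj a\<^sub>j) / K\<^sub>n(z) \<cdot> P(\<bar>\<Phi>\<^sub>n(z)\<bar> > \<bar>v\<bar>)\<close> (\<open>expectation_linear_ratio\<close>): unitary invariance of the
  Gaussian allows \<open>z \<Phi>\<^sub>n'(z)\<close> to be replaced by its projection onto \<open>\<Phi>\<^sub>n(z)\<close>, and the mean of
  \<open>X / (X - v)\<close> over the phase of \<open>X\<close> is 1 or 0 according to whether \<open>\<bar>X\<bar> > \<bar>v\<bar>\<close> or \<open>\<bar>X\<bar> < \<bar>v\<bar>\<close>.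

  Thirdly, on the unit circle the real part of \<open>\<Sum> b\<^sub>j cnj a\<^sub>j\<close> equals \<open>n K\<^sub>n(z) / 2\<close> exactly
  (\<open>Re_kernel_deriv\<close>). Reversal \<open>p \<mapsto> z\<^sup>n cnj (p (1 / cnj z))\<close> is an antiunitary involution of the
  polynomials of degree at most \<open>n\<close>, so it preserves the reproducing kernel, and it exchanges the
  inside and the outside of the disk.

  Circles of radius below 1 are used and the radius is then sent to 1. In this way roots
  on the unit circle itself never have to be excluded, and the root count appears as a limit of
  measurable functions of the coefficients.\<close>

section \<open>Circle means and roots in the disk\<close>

text \<open>The arguments of a given point differ by multiples of \<open>2 pi\<close>, so there are only countably many.\<close>

lemma AE_cis_neq: "AE t in lborel. cis t \<noteq> w"
proof -
  have "{t. cis t = w} \<subseteq> range (\<lambda>k::int. Arg w + 2 * pi * of_int k)"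
  proof safe
    fix t assume "w = cis t"
    hence "cis (Arg (cis t)) = cis t" by (simp add: cis_Arg sgn_div_norm)
    hence "exp (\<i> * of_real t) = exp (\<i> * of_real (Arg (cis t)))"
      by (simp add: cis_conv_exp)
    then obtain k :: int where "\<i> * of_real t = \<i> * of_real (Arg (cis t)) + (of_int (2 * k) * pi) * \<i>"
      unfolding exp_eq by auto
    hence "\<i> * complex_of_real t = \<i> * complex_of_real (Arg (cis t) + 2 * pi * of_int k)"
      by (simp add: algebra_simps)
    hence "t = Arg (cis t) + 2 * pi * of_int k"
      by (simp only: mult_cancel_left of_real_eq_iff) simp
    thus "t \<in> range (\<lambda>k::int. Arg (cis t) + 2 * pi * of_int k)" by blast
  qed
  hence "countable {t. cis t = w}" by (rule countable_subset) simp
  hence "{t. cis t = w} \<in> null_sets lborel" by (rule countable_imp_null_set_lborel)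
  thus ?thesis by (rule AE_I') auto
qed

text \<open>Normalized arc length on the circle. The parameter interval from \<open>0\<close> to \<open>2 pi\<close> is that of
  \<open>circlepath\<close>; its two ends name the same point, which has measure zero.\<close>

definition unif_angle :: "real measure" where
  "unif_angle = uniform_measure lborel {0..2*pi}"

lemma sets_unif_angle [simp, measurable_cong]: "sets unif_angle = sets borel"
  and space_unif_angle [simp]: "space unif_angle = UNIV"
  by (simp_all add: unif_angle_def)

lemma prob_space_unif_angle: "prob_space unif_angle"
  unfolding unif_angle_def by (rule prob_space_uniform_measure) auto

interpretation unif_angle: prob_space unif_angle
  by (rule prob_space_unif_angle)

lemma AE_unif_angle: "AE t in lborel. Q t \<Longrightarrow> AE t in unif_angle. Q t"
  unfolding unif_angle_def by (subst AE_uniform_measure) auto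

lemma AE_circle_neq:
  assumes "r > 0"
  shows "AE t in unif_angle. of_real r * cis t \<noteq> w"
  by (rule AE_unif_angle, rule AE_mp[OF AE_cis_neq[of "w / of_real r"]])
     (use assms in \<open>auto simp: field_simps\<close>)

lemma unif_angle_density:
  "unif_angle = density lborel (\<lambda>t. ennreal (indicator {0..2*pi} t / (2*pi)))"
  unfolding unif_angle_def uniform_measure_def
  by (intro density_cong) (auto simp: divide_ennreal[symmetric] split: split_indicator)

lemma measurable_cis [measurable]: "cis \<in> borel_measurable borel"
  by (intro borel_measurable_continuous_onI continuous_intros)

lemma integral_unif_angle:
  fixes f :: "real \<Rightarrow> complex"
  assumes [measurable]: "f \<in> borel_measurable borel" and cont: "continuous_on {0..2*pi} f"
  shows "integrable unif_angle f"
    and "(\<integral>t. f t \<partial>unif_angle) = integral {0..2*pi} f / (2 * pi)"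
proof -
  have int: "set_integrable lborel {0..2*pi} f"
    by (rule borel_integrable_atLeastAtMost'[OF cont])
  have eq: "(indicator {0..2*pi} t / (2*pi)) *\<^sub>R f t = indicator {0..2*pi} t *\<^sub>R f t / (2 * pi)" for t
    by (simp add: scaleR_conv_of_real)
  show "integrable unif_angle f"
    unfolding unif_angle_density
    by (subst integrable_density) (use int in \<open>auto simp: eq set_integrable_def\<close>)
  have "(\<integral>t. f t \<partial>unif_angle) = (LINT t:{0..2*pi}|lborel. f t) / (2 * pi)"
    unfolding unif_angle_density set_lebesgue_integral_def
    by (subst integral_density) (auto simp: eq)
  thus "(\<integral>t. f t \<partial>unif_angle) = integral {0..2*pi} f / (2 * pi)"
    by (simp only: set_borel_integral_eq_integral(2)[OF int])
qed

text \<open>This is \<open>1 / (2 pi \<i>)\<close> times the contour integral of \<open>1 / (z - w)\<close>. It serves twice: for counting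
  roots, and for averaging \<open>X / (X - v)\<close> over the phase of a Gaussian \<open>X\<close>.\<close>

lemma circle_mean_cauchy_factor:
  assumes r: "r > 0" and w: "cmod w \<noteq> r"
  shows "(\<integral>t. of_real r * cis t / (of_real r * cis t - w) \<partial>unif_angle) = (if cmod w < r then 1 else 0)"
proof -
  let ?f = "\<lambda>t. of_real r * cis t / (of_real r * cis t - w)"
  have nz: "of_real r * cis t - w \<noteq> 0" for t
    using w r by (metis eq_iff_diff_eq_0 norm_mult norm_cis mult.right_neutral norm_of_real abs_of_pos)
  have cont: "continuous_on {0..2*pi} ?f"
    using nz by (intro continuous_intros) auto
  have meas: "?f \<in> borel_measurable borel" by measurable
  have conv: "integral {0..2*pi} ?f = I / \<i>"
    if "((\<lambda>z. 1 / (z - w)) has_contour_integral I) (circlepath 0 r)" for I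
  proof -
    have "((\<lambda>t. 1 / (0 + of_real r * cis t - w) * of_real r * \<i> * cis t) has_integral I) {0..2*pi}"
      using that unfolding circlepath_def
      by (subst (asm) has_contour_integral_part_circlepath_iff) auto
    hence "((\<lambda>t. 1 / (0 + of_real r * cis t - w) * of_real r * \<i> * cis t * (1 / \<i>)) has_integral I * (1 / \<i>)) {0..2*pi}"
      by (rule has_integral_mult_left)
    also have "(\<lambda>t. 1 / (0 + of_real r * cis t - w) * of_real r * \<i> * cis t * (1 / \<i>)) = ?f"
    proof
      have "1 / d * a * \<i> * c * (1 / \<i>) = 1 / d * a * c * (\<i> * (1 / \<i>))" for a c d :: complex
        by (simp only: mult_ac)
      thus "1 / (0 + of_real r * cis t - w) * of_real r * \<i> * cis t * (1 / \<i>) = ?f t" for t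
        by simp
    qed
    finally show ?thesis by (simp add: integral_unique)
  qed
  show ?thesis
  proof (cases "cmod w < r")
    case True
    have "((\<lambda>z. 1 / (z - w)) has_contour_integral 2 * of_real pi * \<i> * 1) (circlepath 0 r)"
      by (rule Cauchy_integral_circlepath_simple) (use True in auto)
    from conv[OF this] show ?thesis using True by (simp add: integral_unif_angle(2)[OF meas cont])
  next
    case False
    hence wr: "cmod w > r" using w by auto
    have "((\<lambda>z. 1 / (z - w)) has_contour_integral 0) (circlepath 0 r)"
    proof (rule Cauchy_theorem_disc_simple[where a=0 and e="cmod w"])
      show "(\<lambda>z. 1 / (z - w)) holomorphic_on ball 0 (cmod w)"
        by (intro holomorphic_intros) auto
      show "path_image (circlepath 0 r) \<subseteq> ball 0 (cmod w)"
        using wr r by auto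
    qed auto
    from conv[OF this] show ?thesis using False by (simp add: integral_unif_angle(2)[OF meas cont])
  qed
qed

text \<open>The deviation from one half is half the Poisson kernel of \<open>w\<close> up to sign; on a circle around the
  origin its sign does not depend on \<open>z\<close>. Only the real part has this property, and it is the reason
  for working with real parts of logarithmic derivatives.\<close>

lemma Re_cauchy_factor:
  assumes "z \<noteq> w"
  shows "Re (z / (z - w)) = 1 / 2 + ((cmod z)\<^sup>2 - (cmod w)\<^sup>2) / (2 * (cmod (z - w))\<^sup>2)"
proof -
  have nz: "(cmod (z - w))\<^sup>2 \<noteq> 0" using assms by simp
  have "Re (z / (z - w)) = Re (z * cnj (z - w)) / (cmod (z - w))\<^sup>2"
    by (subst complex_div_cnj) (simp add: Re_divide_of_real del: of_real_power complex_cnj_diff flip: complex_norm_square)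
  moreover have "2 * Re (z * cnj (z - w)) = (cmod (z - w))\<^sup>2 + ((cmod z)\<^sup>2 - (cmod w)\<^sup>2)"
    unfolding cmod_power2 by (simp add: power2_eq_square algebra_simps)
  ultimately show ?thesis using nz by (simp add: field_simps)
qed

text \<open>The \<open>L\<^sup>1\<close> bound is uniform in \<open>w\<close>, even as \<open>w\<close> approaches the circle, because the deviation from one
  half has constant sign and its mean is plus or minus one half; for \<open>w\<close> on the circle it vanishes.\<close>

lemma circle_mean_Re_cauchy_factor:
  assumes r: "r > 0"
  defines "f \<equiv> \<lambda>w t. Re (of_real r * cis t / (of_real r * cis t - w))"
  shows "integrable unif_angle (f w)"
    and "(\<integral>t. \<bar>f w t\<bar> \<partial>unif_angle) \<le> 1"
    and "cmod w < r \<Longrightarrow> (\<integral>t. f w t \<partial>unif_angle) = 1"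
    and "cmod w > r \<Longrightarrow> (\<integral>t. f w t \<partial>unif_angle) = 0"
proof -
  have [measurable]: "f w \<in> borel_measurable borel" unfolding f_def by measurable
  have cint: "integrable unif_angle (\<lambda>t. of_real r * cis t / (of_real r * cis t - w))" if "cmod w \<noteq> r"
  proof -
    have nz: "of_real r * cis t - w \<noteq> 0" for t
      using that r by (metis eq_iff_diff_eq_0 norm_mult norm_cis mult.right_neutral norm_of_real abs_of_pos)
    have cont: "continuous_on {0..2*pi} (\<lambda>t. of_real r * cis t / (of_real r * cis t - w))"
      using nz by (intro continuous_intros) auto
    show ?thesis by (rule integral_unif_angle(1)[OF _ cont]) measurable
  qed
  have eq: "f w t = 1 / 2 + (r\<^sup>2 - (cmod w)\<^sup>2) / (2 * (cmod (of_real r * cis t - w))\<^sup>2)"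
    if "of_real r * cis t \<noteq> w" for t
    unfolding f_def Re_cauchy_factor[OF that] using r by (simp add: norm_mult)
  consider "cmod w < r" | "cmod w > r" | "cmod w = r" by linarith
  hence "integrable unif_angle (f w) \<and> (\<integral>t. \<bar>f w t\<bar> \<partial>unif_angle) \<le> 1 \<and>
    (cmod w < r \<longrightarrow> (\<integral>t. f w t \<partial>unif_angle) = 1) \<and> (cmod w > r \<longrightarrow> (\<integral>t. f w t \<partial>unif_angle) = 0)"
  proof cases
    case 1
    have int: "integrable unif_angle (f w)" unfolding f_def using cint 1 by auto
    have one: "(\<integral>t. f w t \<partial>unif_angle) = 1"
      unfolding f_def using cint 1 circle_mean_cauchy_factor[OF r, of w] by (subst integral_Re) auto
    have "f w t \<ge> 0" for t
    proof (cases "of_real r * cis t = w")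
      case False
      thus ?thesis using 1 r by (subst eq) (auto intro!: add_nonneg_nonneg divide_nonneg_nonneg power_mono)
    qed (auto simp: f_def)
    thus ?thesis using int one 1 by simp
  next
    case 2
    have int: "integrable unif_angle (f w)" unfolding f_def using cint 2 by auto
    have zero: "(\<integral>t. f w t \<partial>unif_angle) = 0"
      unfolding f_def using cint 2 circle_mean_cauchy_factor[OF r, of w] by (subst integral_Re) auto
    have "f w t \<le> 1 / 2" for t
    proof (cases "of_real r * cis t = w")
      case False
      have "r\<^sup>2 \<le> (cmod w)\<^sup>2" using 2 r by (intro power_mono) auto
      thus ?thesis by (subst eq[OF False]) (simp add: divide_nonpos_nonneg)
    qed (auto simp: f_def)
    hence "\<bar>f w t\<bar> \<le> 1 - f w t" for t by (smt (verit) field_sum_of_halves)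
    hence "(\<integral>t. \<bar>f w t\<bar> \<partial>unif_angle) \<le> (\<integral>t. 1 - f w t \<partial>unif_angle)"
      using int by (intro integral_mono) auto
    also have "\<dots> = 1" using int zero by (simp add: unif_angle.prob_space[simplified])
    finally show ?thesis using int zero 2 by simp
  next
    case 3
    have b: "\<bar>f w t\<bar> \<le> 1" for t
    proof (cases "of_real r * cis t = w")
      case False
      show ?thesis by (subst eq[OF False]) (simp add: 3)
    qed (auto simp: f_def)
    hence int: "integrable unif_angle (f w)"
      by (intro unif_angle.integrable_const_bound[of _ 1]) auto
    have "(\<integral>t. \<bar>f w t\<bar> \<partial>unif_angle) \<le> (\<integral>t. 1 \<partial>unif_angle)"
      using int b by (intro integral_mono) auto
    thus ?thesis using int 3 by (simp add: unif_angle.prob_space[simplified])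
  qed
  thus "integrable unif_angle (f w)" "(\<integral>t. \<bar>f w t\<bar> \<partial>unif_angle) \<le> 1"
    "cmod w < r \<Longrightarrow> (\<integral>t. f w t \<partial>unif_angle) = 1"
    "cmod w > r \<Longrightarrow> (\<integral>t. f w t \<partial>unif_angle) = 0" by blast+
qed

lemma poly_log_deriv:
  fixes p :: "complex poly"
  assumes "poly p z \<noteq> 0"
  shows "poly (pderiv p) z / poly p z = (\<Sum>w\<in>#proots p. 1 / (z - w))"
proof -
  have gen: "poly (pderiv (\<Prod>x\<in>#M. [:-x, 1:])) z / poly (\<Prod>x\<in>#M. [:-x, 1:]) z = (\<Sum>w\<in>#M. 1 / (z - w))"
    if "poly (\<Prod>x\<in>#M. [:-x, 1:]) z \<noteq> 0" for M :: "complex multiset"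
    using that
  proof (induction M)
    case (add w M)
    have nz: "z - w \<noteq> 0" "poly (\<Prod>x\<in>#M. [:-x, 1:]) z \<noteq> 0" using add.prems by auto
    have pd: "pderiv [:- w, 1:] = 1" by (simp add: pderiv_pCons one_pCons)
    have "poly (pderiv (\<Prod>x\<in>#add_mset w M. [:-x, 1:])) z / poly (\<Prod>x\<in>#add_mset w M. [:-x, 1:]) z
      = 1 / (z - w) + poly (pderiv (\<Prod>x\<in>#M. [:-x, 1:])) z / poly (\<Prod>x\<in>#M. [:-x, 1:]) z"
    proof -
      let ?q = "\<Prod>x\<in>#M. [:-x, 1:]"
      have "pderiv (\<Prod>x\<in>#add_mset w M. [:-x, 1:]) = [:-w, 1:] * pderiv ?q + ?q * pderiv [:-w, 1:]"
        by (simp only: image_mset_add_mset prod_mset.add_mset pderiv_mult)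
      hence "poly (pderiv (\<Prod>x\<in>#add_mset w M. [:-x, 1:])) z = (z - w) * poly (pderiv ?q) z + poly ?q z"
        by (simp only: pd poly_add poly_mult) (simp add: algebra_simps)
      moreover have "poly (\<Prod>x\<in>#add_mset w M. [:-x, 1:]) z = (z - w) * poly ?q z"
        by (simp add: algebra_simps)
      ultimately show ?thesis using nz by (simp only:) (simp add: field_simps)
    qed
    thus ?case using add.IH nz by simp
  qed simp
  have p: "p = smult (lead_coeff p) (\<Prod>x\<in>#proots p. [:-x, 1:])"
    by (rule complex_poly_decompose_multiset[symmetric])
  have nz: "poly (\<Prod>x\<in>#proots p. [:-x, 1:]) z \<noteq> 0" "lead_coeff p \<noteq> 0"
    using assms by (subst (asm) p; auto)+
  have "poly (pderiv p) z / poly p z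
     = poly (pderiv (\<Prod>x\<in>#proots p. [:-x, 1:])) z / poly (\<Prod>x\<in>#proots p. [:-x, 1:]) z"
    by (subst (1 2) p) (use nz(2) in \<open>simp add: pderiv_smult\<close>)
  thus ?thesis using gen[OF nz(1)] by simp
qed

text \<open>Division by zero makes this 0 at the roots of \<open>p\<close> and identically 0 for \<open>p = 0\<close>. The latter agrees
  with the convention that the zero polynomial has no roots.\<close>

definition log_deriv_re :: "complex poly \<Rightarrow> complex \<Rightarrow> real" where
  "log_deriv_re p z = Re (z * poly (pderiv p) z / poly p z)"

lemma circle_mean_sum_mset:
  assumes r: "r > 0"
  defines "f \<equiv> \<lambda>w t. Re (of_real r * cis t / (of_real r * cis t - w))"
  shows "integrable unif_angle (\<lambda>t. \<Sum>w\<in>#M. f w t)"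
    and "(\<integral>t. \<bar>\<Sum>w\<in>#M. f w t\<bar> \<partial>unif_angle) \<le> size M"
    and "(\<integral>t. (\<Sum>w\<in>#M. f w t) \<partial>unif_angle) = (\<Sum>w\<in>#M. \<integral>t. f w t \<partial>unif_angle)"
proof -
  have base: "integrable unif_angle (f w)" "(\<integral>t. \<bar>f w t\<bar> \<partial>unif_angle) \<le> 1" for w
    unfolding f_def by (rule circle_mean_Re_cauchy_factor[OF r])+
  have "integrable unif_angle (\<lambda>t. \<Sum>w\<in>#M. f w t) \<and>
    (\<integral>t. \<bar>\<Sum>w\<in>#M. f w t\<bar> \<partial>unif_angle) \<le> size M \<and>
    (\<integral>t. (\<Sum>w\<in>#M. f w t) \<partial>unif_angle) = (\<Sum>w\<in>#M. \<integral>t. f w t \<partial>unif_angle)"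
  proof (induction M)
    case (add w M)
    hence int: "integrable unif_angle (\<lambda>t. \<Sum>w\<in>#M. f w t)" by simp
    have "(\<integral>t. \<bar>f w t + (\<Sum>w\<in>#M. f w t)\<bar> \<partial>unif_angle)
       \<le> (\<integral>t. \<bar>f w t\<bar> + \<bar>\<Sum>w\<in>#M. f w t\<bar> \<partial>unif_angle)"
      using int base(1)[of w]
      by (intro integral_mono integrable_abs Bochner_Integration.integrable_add) auto
    also have "\<dots> \<le> 1 + size M"
      using add int base(1,2)[of w] by simp
    finally show ?case using add int base(1)[of w] by simp
  qed simp
  thus "integrable unif_angle (\<lambda>t. \<Sum>w\<in>#M. f w t)"
    "(\<integral>t. \<bar>\<Sum>w\<in>#M. f w t\<bar> \<partial>unif_angle) \<le> size M"
    "(\<integral>t. (\<Sum>w\<in>#M. f w t) \<partial>unif_angle) = (\<Sum>w\<in>#M. \<integral>t. f w t \<partial>unif_angle)" by blast+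
qed

lemma AE_log_deriv_re:
  assumes r: "r > 0" and p: "p \<noteq> 0"
  shows "AE t in unif_angle. log_deriv_re p (of_real r * cis t)
      = (\<Sum>w\<in>#proots p. Re (of_real r * cis t / (of_real r * cis t - w)))"
proof -
  have "finite {w. poly p w = 0}" using p by (rule poly_roots_finite)
  hence "AE t in unif_angle. \<forall>w\<in>{w. poly p w = 0}. of_real r * cis t \<noteq> w"
    using AE_circle_neq[OF r] by (subst AE_finite_all) auto
  moreover have "log_deriv_re p (of_real r * cis t)
      = (\<Sum>w\<in>#proots p. Re (of_real r * cis t / (of_real r * cis t - w)))"
    if "\<forall>w\<in>{w. poly p w = 0}. of_real r * cis t \<noteq> w" for t
  proof -
    have Re_sum: "Re (z * (\<Sum>w\<in>#M. 1 / (z - w))) = (\<Sum>w\<in>#M. Re (z / (z - w)))" for z and M :: "complex multiset"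
      by (induction M) (simp_all add: algebra_simps)
    have nz: "poly p (of_real r * cis t) \<noteq> 0" using that by auto
    show ?thesis
      unfolding log_deriv_re_def times_divide_eq_right[symmetric] poly_log_deriv[OF nz] Re_sum by simp
  qed
  ultimately show ?thesis by (auto elim!: eventually_mono)
qed

lemma measurable_log_deriv_re [measurable]: "log_deriv_re p \<in> borel_measurable borel"
proof -
  have [measurable]: "poly q \<in> borel_measurable borel" for q :: "complex poly"
    by (intro borel_measurable_continuous_onI continuous_intros)
  show ?thesis unfolding log_deriv_re_def by measurable
qed

lemma log_deriv_re_0 [simp]: "log_deriv_re 0 z = 0"
  by (simp add: log_deriv_re_def)

text \<open>A bound that depends on the degree alone: applied to a random polynomial it makes expectation and
  circle mean interchangeable, without an estimate of how close the roots come to the circle.\<close>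

lemma log_deriv_re_L1_bound:
  assumes r: "r > 0"
  shows "integrable unif_angle (\<lambda>t. log_deriv_re p (of_real r * cis t))"
    and "(\<integral>t. \<bar>log_deriv_re p (of_real r * cis t)\<bar> \<partial>unif_angle) \<le> degree p"
proof -
  have "integrable unif_angle (\<lambda>t. log_deriv_re p (of_real r * cis t)) \<and>
    (\<integral>t. \<bar>log_deriv_re p (of_real r * cis t)\<bar> \<partial>unif_angle) \<le> degree p"
  proof (cases "p = 0")
    case False
    note ae = AE_log_deriv_re[OF r False]
    have "integrable unif_angle (\<lambda>t. log_deriv_re p (of_real r * cis t))"
      by (subst integrable_cong_AE[OF _ _ ae])
         (use circle_mean_sum_mset(1)[OF r, of "proots p"] in \<open>auto simp: borel_measurable_integrable\<close>)
    moreover have "(\<integral>t. \<bar>log_deriv_re p (of_real r * cis t)\<bar> \<partial>unif_angle)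
       = (\<integral>t. \<bar>\<Sum>w\<in>#proots p. Re (of_real r * cis t / (of_real r * cis t - w))\<bar> \<partial>unif_angle)"
      by (rule integral_cong_AE)
         (use ae circle_mean_sum_mset(1)[OF r, of "proots p"] in \<open>auto simp: borel_measurable_integrable\<close>)
    ultimately show ?thesis
      using circle_mean_sum_mset(2)[OF r, of "proots p"] by (simp add: size_proots_complex)
  qed simp
  thus "integrable unif_angle (\<lambda>t. log_deriv_re p (of_real r * cis t))"
    "(\<integral>t. \<bar>log_deriv_re p (of_real r * cis t)\<bar> \<partial>unif_angle) \<le> degree p" by blast+
qed

text \<open>The mean over the circle of radius \<open>r\<close> counts the roots of modulus below \<open>r\<close> unless a root lies on the
  circle. There are finitely many roots, so the count is exact for \<open>r\<close> close to 1, and the circles of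
  radius below 1 do not see roots of modulus 1.\<close>

lemma circle_mean_log_deriv_tendsto_disk_roots:
  assumes r: "\<And>k. 0 < r k" "\<And>k. r k < 1" "r \<longlonglongrightarrow> (1::real)"
  shows "(\<lambda>k. \<integral>t. log_deriv_re (p - [:v:]) (of_real (r k) * cis t) \<partial>unif_angle)
           \<longlonglongrightarrow> real (disk_roots p v)"
proof -
  define q where "q = p - [:v:]"
  have lim: "(\<lambda>k. \<Sum>w\<in>#M. \<integral>t. Re (of_real (r k) * cis t / (of_real (r k) * cis t - w)) \<partial>unif_angle)
      \<longlonglongrightarrow> real (size {#z \<in># M. z \<in> ball 0 1#})" for M
  proof (induction M)
    case (add w M)
    have "(\<lambda>k. \<integral>t. Re (of_real (r k) * cis t / (of_real (r k) * cis t - w)) \<partial>unif_angle)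
        \<longlonglongrightarrow> (if w \<in> ball 0 1 then 1 else 0)"
    proof (cases "cmod w < 1")
      case True
      hence "eventually (\<lambda>k. cmod w < r k) sequentially"
        using order_tendstoD(1)[OF r(3)] by blast
      hence "eventually (\<lambda>k. (\<integral>t. Re (of_real (r k) * cis t / (of_real (r k) * cis t - w)) \<partial>unif_angle) = 1) sequentially"
        by eventually_elim (rule circle_mean_Re_cauchy_factor(3)[OF r(1)])
      thus ?thesis using True by (auto intro: tendsto_eventually)
    next
      case False
      have "(\<integral>t. Re (of_real (r k) * cis t / (of_real (r k) * cis t - w)) \<partial>unif_angle) = 0" for k
        using False r(2)[of k] by (intro circle_mean_Re_cauchy_factor(4)[OF r(1)]) auto
      thus ?thesis using False by auto
    qed
    from tendsto_add[OF this add.IH] show ?case by (auto split: if_splits)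
  qed simp
  show ?thesis
  proof (cases "q = 0")
    case True
    thus ?thesis by (simp add: disk_roots_def flip: q_def)
  next
    case False
    have "(\<integral>t. log_deriv_re q (of_real (r k) * cis t) \<partial>unif_angle)
      = (\<Sum>w\<in>#proots q. \<integral>t. Re (of_real (r k) * cis t / (of_real (r k) * cis t - w)) \<partial>unif_angle)" for k
      unfolding circle_mean_sum_mset(3)[OF r(1), symmetric]
      by (rule integral_cong_AE)
         (use AE_log_deriv_re[OF r(1) False] circle_mean_sum_mset(1)[OF r(1)[of k], of "proots q"]
           in \<open>auto simp: borel_measurable_integrable\<close>)
    thus ?thesis unfolding disk_roots_def q_def[symmetric] using lim[of "proots q"] by simp
  qed
qed

section \<open>Unitary invariance of the planar Gaussian\<close>

definition cgauss :: "complex measure" where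
  "cgauss = density lborel std_complex_normal_density"

lemma lborel_shear_fst:
  fixes c :: complex
  shows "distr lborel borel (\<lambda>p. (fst p + c * snd p, snd p)) = (lborel :: (complex \<times> complex) measure)"
proof (rule measure_eqI)
  fix A :: "(complex \<times> complex) set"
  assume "A \<in> sets (distr lborel borel (\<lambda>p. (fst p + c * snd p, snd p)))"
  hence A [measurable]: "A \<in> sets borel" by simp
  have A' [measurable]: "A \<in> sets (borel \<Otimes>\<^sub>M borel)" using A by (simp only: borel_prod)
  have m [measurable]: "(\<lambda>p. (fst p + c * snd p, snd p)) \<in> borel_measurable (borel :: (complex \<times> complex) measure)"
    by (simp add: borel_prod[symmetric])
  have "emeasure (distr lborel borel (\<lambda>p. (fst p + c * snd p, snd p))) A
      = (\<integral>\<^sup>+p. indicator A (fst p + c * snd p, snd p) \<partial>(lborel \<Otimes>\<^sub>M lborel :: (complex \<times> complex) measure))"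
    by (simp add: nn_integral_distr lborel_prod del: nn_integral_indicator flip: nn_integral_indicator)
  also have "\<dots> = (\<integral>\<^sup>+y. \<integral>\<^sup>+x. indicator A (x + c * y, y) \<partial>lborel \<partial>lborel)"
    by (subst lborel_pair.nn_integral_snd[symmetric]) simp_all
  also have "\<dots> = (\<integral>\<^sup>+y. \<integral>\<^sup>+x. indicator A (x, y) \<partial>lborel \<partial>lborel)"
  proof (rule nn_integral_cong)
    fix y :: complex
    have "(\<integral>\<^sup>+x. indicator A (x, y) \<partial>lborel) = (\<integral>\<^sup>+x. indicator A (x, y) \<partial>distr lborel borel ((+) (c * y)))"
      by (simp only: lborel_distr_plus)
    also have "\<dots> = (\<integral>\<^sup>+x. indicator A (x + c * y, y) \<partial>lborel)"
      by (subst nn_integral_distr) (simp_all add: add.commute)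
    finally show "(\<integral>\<^sup>+x. indicator A (x + c * y, y) \<partial>lborel) = (\<integral>\<^sup>+x. indicator A (x, y) \<partial>lborel)"
      by simp
  qed
  also have "\<dots> = (\<integral>\<^sup>+p. indicator A p \<partial>(lborel \<Otimes>\<^sub>M lborel :: (complex \<times> complex) measure))"
    by (subst lborel_pair.nn_integral_snd[symmetric]) simp_all
  also have "\<dots> = emeasure lborel A" by (simp add: lborel_prod)
  finally show "emeasure (distr lborel borel (\<lambda>p. (fst p + c * snd p, snd p))) A = emeasure lborel A" .
qed simp

lemma lborel_shear_snd:
  fixes c :: complex
  shows "distr lborel borel (\<lambda>p. (fst p, snd p + c * fst p)) = (lborel :: (complex \<times> complex) measure)"
proof (rule measure_eqI)
  fix A :: "(complex \<times> complex) set"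
  assume "A \<in> sets (distr lborel borel (\<lambda>p. (fst p, snd p + c * fst p)))"
  hence A [measurable]: "A \<in> sets borel" by simp
  have A' [measurable]: "A \<in> sets (borel \<Otimes>\<^sub>M borel)" using A by (simp only: borel_prod)
  have m [measurable]: "(\<lambda>p. (fst p, snd p + c * fst p)) \<in> borel_measurable (borel :: (complex \<times> complex) measure)"
    by (simp add: borel_prod[symmetric])
  have "emeasure (distr lborel borel (\<lambda>p. (fst p, snd p + c * fst p))) A
      = (\<integral>\<^sup>+p. indicator A (fst p, snd p + c * fst p) \<partial>(lborel \<Otimes>\<^sub>M lborel :: (complex \<times> complex) measure))"
    by (simp add: nn_integral_distr lborel_prod del: nn_integral_indicator flip: nn_integral_indicator)
  also have "\<dots> = (\<integral>\<^sup>+x. \<integral>\<^sup>+y. indicator A (x, y + c * x) \<partial>lborel \<partial>lborel)"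
    by (subst lborel.nn_integral_fst[symmetric]) simp_all
  also have "\<dots> = (\<integral>\<^sup>+x. \<integral>\<^sup>+y. indicator A (x, y) \<partial>lborel \<partial>lborel)"
  proof (rule nn_integral_cong)
    fix x :: complex
    have "(\<integral>\<^sup>+y. indicator A (x, y) \<partial>lborel) = (\<integral>\<^sup>+y. indicator A (x, y) \<partial>distr lborel borel ((+) (c * x)))"
      by (simp only: lborel_distr_plus)
    also have "\<dots> = (\<integral>\<^sup>+y. indicator A (x, y + c * x) \<partial>lborel)"
      by (subst nn_integral_distr) (simp_all add: add.commute)
    finally show "(\<integral>\<^sup>+y. indicator A (x, y + c * x) \<partial>lborel) = (\<integral>\<^sup>+y. indicator A (x, y) \<partial>lborel)"
      by simp
  qed
  also have "\<dots> = (\<integral>\<^sup>+p. indicator A p \<partial>(lborel \<Otimes>\<^sub>M lborel :: (complex \<times> complex) measure))"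
    by (subst lborel.nn_integral_fst[symmetric]) simp_all
  also have "\<dots> = emeasure lborel A" by (simp add: lborel_prod)
  finally show "emeasure (distr lborel borel (\<lambda>p. (fst p, snd p + c * fst p))) A = emeasure lborel A" .
qed simp

text \<open>For \<open>\<bar>\<alpha>\<bar>\<^sup>2 + \<bar>\<beta>\<bar>\<^sup>2 = 1\<close>, the general element of \<open>SU(2)\<close>.\<close>

definition planar_rotation :: "complex \<Rightarrow> complex \<Rightarrow> complex \<times> complex \<Rightarrow> complex \<times> complex" where
  "planar_rotation \<alpha> \<beta> p = (\<alpha> * fst p + \<beta> * snd p, - cnj \<beta> * fst p + cnj \<alpha> * snd p)"

lemma measurable_planar_rotation [measurable]:
  "planar_rotation \<alpha> \<beta> \<in> borel_measurable borel"
  unfolding planar_rotation_def by (simp add: borel_prod[symmetric])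

text \<open>For \<open>\<beta> \<noteq> 0\<close> an element of \<open>SU(2)\<close> is a product of three shears, and a shear preserves Lebesgue measure
  by Fubini and translation invariance. A diagonal element is a product of two with \<open>\<alpha> = 0\<close>.\<close>

lemma lborel_planar_rotation:
  assumes "(cmod \<alpha>)\<^sup>2 + (cmod \<beta>)\<^sup>2 = 1"
  shows "distr lborel borel (planar_rotation \<alpha> \<beta>) = lborel"
proof -
  have main: "distr lborel borel (planar_rotation \<alpha> \<beta>) = lborel"
    if norm: "(cmod \<alpha>)\<^sup>2 + (cmod \<beta>)\<^sup>2 = 1" and nz: "\<beta> \<noteq> 0" for \<alpha> \<beta>
  proof -
    \<comment> \<open>the rotation is the product of the shears \<open>(1 x; 0 1)\<close>, \<open>(1 0; - cnj \<beta> 1)\<close> and \<open>(1 y; 0 1)\<close>\<close>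
    define x where "x = (1 - \<alpha>) / cnj \<beta>"
    define y where "y = (1 - cnj \<alpha>) / cnj \<beta>"
    let ?X = "\<lambda>p::complex \<times> complex. (fst p + x * snd p, snd p)"
    let ?Y = "\<lambda>p::complex \<times> complex. (fst p + y * snd p, snd p)"
    let ?S = "\<lambda>p::complex \<times> complex. (fst p, snd p + (- cnj \<beta>) * fst p)"
    have m [measurable]: "?X \<in> borel_measurable borel" "?Y \<in> borel_measurable borel" "?S \<in> borel_measurable borel"
      by (simp_all add: borel_prod[symmetric])
    have n': "\<alpha> * cnj \<alpha> + \<beta> * cnj \<beta> = 1"
      using norm by (simp flip: complex_norm_square of_real_power of_real_add)
    have xb: "x * cnj \<beta> = 1 - \<alpha>" "y * cnj \<beta> = 1 - cnj \<alpha>"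
      using nz by (simp_all add: x_def y_def)
    have al: "\<alpha> = 1 - x * cnj \<beta>" "cnj \<alpha> = 1 - y * cnj \<beta>" using xb by auto
    have "(\<alpha> * y + x - \<beta>) * cnj \<beta> = 0"
    proof -
      have "(\<alpha> * y + x - \<beta>) * cnj \<beta> = \<alpha> * (y * cnj \<beta>) + x * cnj \<beta> - \<beta> * cnj \<beta>"
        by (simp add: algebra_simps)
      also have "\<dots> = 1 - (\<alpha> * cnj \<alpha> + \<beta> * cnj \<beta>)"
        unfolding xb by (simp add: algebra_simps)
      finally show ?thesis using n' by simp
    qed
    hence be: "\<alpha> * y + x = \<beta>" using nz by auto
    have eq: "planar_rotation \<alpha> \<beta> = ?X \<circ> (?S \<circ> ?Y)"
    proof
      fix p
      have "fst p + y * snd p + x * (snd p - cnj \<beta> * (fst p + y * snd p))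
          = (1 - x * cnj \<beta>) * fst p + ((1 - x * cnj \<beta>) * y + x) * snd p"
        by (simp add: algebra_simps)
      hence "\<alpha> * fst p + \<beta> * snd p = fst p + y * snd p + x * (snd p - cnj \<beta> * (fst p + y * snd p))"
        by (simp only: al(1)[symmetric] be)
      moreover have "snd p - cnj \<beta> * (fst p + y * snd p) = - cnj \<beta> * fst p + (1 - y * cnj \<beta>) * snd p"
        by (simp add: algebra_simps)
      hence "- cnj \<beta> * fst p + cnj \<alpha> * snd p = snd p - cnj \<beta> * (fst p + y * snd p)"
        by (simp only: al(2)[symmetric])
      ultimately show "planar_rotation \<alpha> \<beta> p = (?X \<circ> (?S \<circ> ?Y)) p"
        by (simp add: planar_rotation_def)
    qed
    have "distr (distr lborel borel ?Y) borel ?S = distr lborel borel (?S \<circ> ?Y)"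
      by (rule distr_distr) (simp_all only: measurable_lborel1 measurable_lborel2 m)
    moreover have "distr (distr lborel borel (?S \<circ> ?Y)) borel ?X = distr lborel borel (?X \<circ> (?S \<circ> ?Y))"
      by (rule distr_distr) (simp_all only: measurable_lborel1 measurable_lborel2 m measurable_comp[OF m(2) m(3)])
    ultimately have "distr lborel borel (planar_rotation \<alpha> \<beta>)
        = distr (distr (distr lborel borel ?Y) borel ?S) borel ?X"
      by (simp only: eq)
    also have "\<dots> = lborel" by (simp only: lborel_shear_fst lborel_shear_snd)
    finally show ?thesis .
  qed
  show ?thesis
  proof (cases "\<beta> = 0")
    case True
    hence "planar_rotation \<alpha> \<beta> = planar_rotation 0 (-1) \<circ> planar_rotation 0 (cnj \<alpha>)"
      by (auto simp: planar_rotation_def fun_eq_iff)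
    moreover have "\<alpha> \<noteq> 0" using assms True by auto
    moreover have "distr (distr lborel borel (planar_rotation 0 (cnj \<alpha>))) borel (planar_rotation 0 (-1)) = lborel"
      using assms True \<open>\<alpha> \<noteq> 0\<close> by (simp add: main)
    ultimately show ?thesis by (simp add: distr_distr)
  qed (use main assms in auto)
qed

lemma cmod_planar_rotation:
  assumes "(cmod \<alpha>)\<^sup>2 + (cmod \<beta>)\<^sup>2 = 1"
  shows "(cmod (fst (planar_rotation \<alpha> \<beta> p)))\<^sup>2 + (cmod (snd (planar_rotation \<alpha> \<beta> p)))\<^sup>2
    = (cmod (fst p))\<^sup>2 + (cmod (snd p))\<^sup>2"
proof -
  obtain x y where p: "p = (x, y)" by (cases p)
  have n': "\<alpha> * cnj \<alpha> + \<beta> * cnj \<beta> = 1"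
    using assms by (simp flip: complex_norm_square of_real_power of_real_add)
  have "complex_of_real ((cmod (\<alpha> * x + \<beta> * y))\<^sup>2 + (cmod (- cnj \<beta> * x + cnj \<alpha> * y))\<^sup>2)
     = (\<alpha> * cnj \<alpha> + \<beta> * cnj \<beta>) * (x * cnj x + y * cnj y)"
    by (simp add: complex_norm_square algebra_simps del: of_real_power)
  also have "\<dots> = complex_of_real ((cmod x)\<^sup>2 + (cmod y)\<^sup>2)"
    unfolding n' by (simp add: complex_norm_square del: of_real_power)
  finally show ?thesis unfolding p planar_rotation_def of_real_eq_iff by simp
qed

lemma measurable_std_complex_normal_density [measurable]:
  "std_complex_normal_density \<in> borel_measurable borel"
  unfolding std_complex_normal_density_def by measurable

lemma sets_cgauss [simp, measurable_cong]: "sets cgauss = sets borel"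
  and space_cgauss [simp]: "space cgauss = UNIV"
  by (simp_all add: cgauss_def)

context
  assumes prob_cgauss: "prob_space cgauss"
begin

lemma cgauss_pair:
  "cgauss \<Otimes>\<^sub>M cgauss
     = density lborel (\<lambda>p. ennreal (exp (- ((cmod (fst p))\<^sup>2 + (cmod (snd p))\<^sup>2)) / pi\<^sup>2))"
proof -
  interpret prob_space cgauss by (rule prob_cgauss)
  have "cgauss \<Otimes>\<^sub>M cgauss = density (lborel \<Otimes>\<^sub>M lborel)
      (\<lambda>(x,y). std_complex_normal_density x * std_complex_normal_density y)"
    unfolding cgauss_def
    by (rule pair_measure_density)
       (use sigma_finite_measure_axioms in \<open>simp_all add: lborel.sigma_finite_measure_axioms cgauss_def[symmetric]\<close>)
  also have "(\<lambda>(x,y). std_complex_normal_density x * std_complex_normal_density y)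
      = (\<lambda>p. ennreal (exp (- ((cmod (fst p))\<^sup>2 + (cmod (snd p))\<^sup>2)) / pi\<^sup>2))"
  proof
    fix p :: "complex \<times> complex"
    have "std_complex_normal_density (fst p) * std_complex_normal_density (snd p)
       = ennreal ((exp (- (cmod (fst p))\<^sup>2) / pi) * (exp (- (cmod (snd p))\<^sup>2) / pi))"
      unfolding std_complex_normal_density_def by (rule ennreal_mult[symmetric]) auto
    also have "(exp (- (cmod (fst p))\<^sup>2) / pi) * (exp (- (cmod (snd p))\<^sup>2) / pi)
       = exp (- ((cmod (fst p))\<^sup>2 + (cmod (snd p))\<^sup>2)) / pi\<^sup>2"
      by (simp add: exp_add[symmetric] power2_eq_square)
    finally show "(case p of (x, y) \<Rightarrow> std_complex_normal_density x * std_complex_normal_density y)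
       = ennreal (exp (- ((cmod (fst p))\<^sup>2 + (cmod (snd p))\<^sup>2)) / pi\<^sup>2)"
      by (simp add: case_prod_beta)
  qed
  finally show ?thesis by (simp add: lborel_prod)
qed

text \<open>The joint density is a function of \<open>\<bar>x\<bar>\<^sup>2 + \<bar>y\<bar>\<^sup>2\<close>, which the rotation preserves along with Lebesgue
  measure.\<close>

lemma cgauss_planar_rotation:
  assumes "(cmod \<alpha>)\<^sup>2 + (cmod \<beta>)\<^sup>2 = 1"
  shows "distr (cgauss \<Otimes>\<^sub>M cgauss) (borel \<Otimes>\<^sub>M borel) (planar_rotation \<alpha> \<beta>) = cgauss \<Otimes>\<^sub>M cgauss"
proof -
  let ?h = "\<lambda>p::complex \<times> complex. ennreal (exp (- ((cmod (fst p))\<^sup>2 + (cmod (snd p))\<^sup>2)) / pi\<^sup>2)"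
  have "?h \<in> borel_measurable (borel \<Otimes>\<^sub>M borel)"
    by measurable
  hence h [measurable]: "?h \<in> borel_measurable borel"
    by (simp only: borel_prod)
  have inv: "(\<lambda>p. ?h (planar_rotation \<alpha> \<beta> p)) = ?h"
    by (simp only: cmod_planar_rotation[OF assms])
  have "distr (density lborel ?h) borel (planar_rotation \<alpha> \<beta>)
     = distr (density lborel (\<lambda>p. ?h (planar_rotation \<alpha> \<beta> p))) borel (planar_rotation \<alpha> \<beta>)"
    by (simp only: inv)
  also have "\<dots> = density (distr lborel borel (planar_rotation \<alpha> \<beta>)) ?h"
    by (rule density_distr[OF h, symmetric]) (simp add: measurable_planar_rotation)
  also have "\<dots> = density lborel ?h" by (simp only: lborel_planar_rotation[OF assms])
  finally show ?thesis unfolding cgauss_pair borel_prod .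
qed

end

section \<open>Gaussian means of functions with a pole\<close>

lemma AE_cgauss: "AE z in lborel. Q z \<Longrightarrow> AE z in cgauss. Q z"
  unfolding cgauss_def by (subst AE_density) auto

lemma AE_cgauss_neq: "AE z in cgauss. z \<noteq> c"
  by (rule AE_cgauss) (rule AE_lborel_singleton)

lemma AE_cgauss_norm_neq: "AE z in cgauss. cmod z \<noteq> t"
proof -
  have "sphere (0::complex) t \<in> null_sets lebesgue"
    using negligible_sphere[of "0::complex" t] by (simp add: negligible_iff_null_sets)
  hence "sphere (0::complex) t \<in> null_sets lborel"
    by (subst (asm) null_sets_completion_iff) auto
  hence "AE z in lborel. cmod z \<noteq> t" by (rule AE_I') auto
  thus ?thesis by (rule AE_cgauss)
qed

lemma emeasure_cgauss_cball:
  assumes "\<rho> \<ge> 0"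
  shows "emeasure cgauss (cball c \<rho>) \<le> ennreal (\<rho>\<^sup>2)"
proof -
  have "emeasure cgauss (cball c \<rho>) = (\<integral>\<^sup>+z. std_complex_normal_density z * indicator (cball c \<rho>) z \<partial>lborel)"
    unfolding cgauss_def by (rule emeasure_density) auto
  also have "\<dots> \<le> (\<integral>\<^sup>+z. ennreal (1 / pi) * indicator (cball c \<rho>) z \<partial>lborel)"
    by (intro nn_integral_mono mult_right_mono)
       (auto simp: std_complex_normal_density_def intro!: ennreal_leI divide_right_mono)
  also have "\<dots> = ennreal (1 / pi) * ennreal (pi * \<rho>\<^sup>2)"
    using assms by (subst nn_integral_cmult_indicator) (simp_all add: emeasure_cball unit_ball_vol_2)
  also have "\<dots> = ennreal (\<rho>\<^sup>2)"
    by (simp flip: ennreal_mult)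
  finally show ?thesis .
qed

text \<open>The probability that a centred complex Gaussian of variance \<open>s\<^sup>2\<close> exceeds \<open>v\<close> in modulus.\<close>

definition exceed_prob :: "complex \<Rightarrow> real \<Rightarrow> real" where
  "exceed_prob v s = measure cgauss {z. cmod v < s * cmod z}"

context
  assumes prob_cgauss: "prob_space cgauss"
begin

interpretation cgauss: prob_space cgauss by (rule prob_cgauss)

lemma cgauss_linear_comb:
  assumes "(cmod \<alpha>)\<^sup>2 + (cmod \<beta>)\<^sup>2 = 1"
  shows "distr (cgauss \<Otimes>\<^sub>M cgauss) borel (\<lambda>p. \<alpha> * fst p + \<beta> * snd p) = cgauss"
proof -
  have "(\<lambda>p. \<alpha> * fst p + \<beta> * snd p) = fst \<circ> planar_rotation \<alpha> \<beta>"
    by (simp add: fun_eq_iff planar_rotation_def)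
  moreover have "planar_rotation \<alpha> \<beta> \<in> measurable (cgauss \<Otimes>\<^sub>M cgauss) (borel \<Otimes>\<^sub>M borel)"
    unfolding planar_rotation_def by measurable
  ultimately have "distr (cgauss \<Otimes>\<^sub>M cgauss) borel (\<lambda>p. \<alpha> * fst p + \<beta> * snd p)
     = distr (distr (cgauss \<Otimes>\<^sub>M cgauss) (borel \<Otimes>\<^sub>M borel) (planar_rotation \<alpha> \<beta>)) borel fst"
    by (subst distr_distr) auto
  also have "\<dots> = distr (cgauss \<Otimes>\<^sub>M cgauss) borel fst"
    by (simp only: cgauss_planar_rotation[OF prob_cgauss assms])
  also have "\<dots> = distr (cgauss \<Otimes>\<^sub>M cgauss) cgauss fst"
    by (rule distr_cong) auto
  also have "\<dots> = cgauss" by (rule cgauss.distr_pair_fst)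
  finally show ?thesis .
qed

lemma cgauss_rotate:
  assumes "cmod u = 1"
  shows "distr cgauss borel (\<lambda>z. u * z) = cgauss"
proof -
  have "distr cgauss borel (\<lambda>z. u * z) = distr (distr (cgauss \<Otimes>\<^sub>M cgauss) cgauss fst) borel (\<lambda>z. u * z)"
    by (simp only: cgauss.distr_pair_fst)
  also have "\<dots> = distr (cgauss \<Otimes>\<^sub>M cgauss) borel (\<lambda>p. u * fst p + 0 * snd p)"
    by (subst distr_distr) (auto simp: o_def)
  also have "\<dots> = cgauss" by (rule cgauss_linear_comb) (use assms in auto)
  finally show ?thesis .
qed

text \<open>A disk of radius \<open>\<rho>\<close> has Gaussian measure at most \<open>\<rho>\<^sup>2\<close>, so a pole of order one is integrable: near
  \<open>c\<close> the function is dominated by the sum of \<open>2 ^ (k + 1)\<close> times the indicators of the dyadic disks.\<close>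

lemma cgauss_integrable_pole: "integrable cgauss (\<lambda>z. 1 / (z - c))"
proof -
  define F where "F z = (\<Sum>k. ennreal (2 ^ Suc k) * indicator (cball c (1 / 2 ^ k)) z)" for z
  have [measurable]: "cball c \<rho> \<in> sets borel" for \<rho>
    by (intro borel_closed closed_cball)
  have [measurable]: "F \<in> borel_measurable borel" unfolding F_def by measurable
  have bound: "ennreal (cmod (1 / (z - c))) \<le> 1 + F z" if "z \<noteq> c" for z
  proof (cases "cmod (z - c) < 1")
    case False
    hence "cmod (1 / (z - c)) \<le> 1" by (simp add: norm_divide divide_le_eq)
    hence "ennreal (cmod (1 / (z - c))) \<le> ennreal 1" by (rule ennreal_leI)
    also have "\<dots> \<le> 1 + F z" by simp
    finally show ?thesis .
  next
    case True
    define d where "d = cmod (z - c)"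
    have d: "0 < d" "d < 1" using that True by (auto simp: d_def)
    have "\<exists>k. (1/2) ^ k < d" using d by (intro real_arch_pow_inv) auto
    then obtain k where k: "(1/2) ^ k < d" and min: "\<And>i. i < k \<Longrightarrow> \<not> (1/2) ^ i < d"
      using exists_least_iff[of "\<lambda>k. (1/2) ^ k < d"] by blast
    have "k \<noteq> 0" using k d by (auto intro: Nat.gr0I)
    then obtain j where j: "k = Suc j" using not0_implies_Suc by blast
    have "d \<le> 1 / 2 ^ j" using min[of j] j by (simp add: power_one_over)
    hence "z \<in> cball c (1 / 2 ^ j)" by (simp add: d_def dist_norm norm_minus_commute)
    moreover have "cmod (1 / (z - c)) \<le> 2 ^ Suc j"
      using k d j unfolding d_def[symmetric] norm_divide by (simp add: field_simps)
    ultimately have "ennreal (cmod (1 / (z - c))) \<le> ennreal (2 ^ Suc j) * indicator (cball c (1 / 2 ^ j)) z"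
      by (simp add: ennreal_leI del: power_Suc)
    also have "\<dots> \<le> F z"
    proof -
      have "f j \<le> (\<Sum>k. f k)" for f :: "nat \<Rightarrow> ennreal"
        using sum_le_suminf[of f "{j}"] by simp
      thus ?thesis unfolding F_def .
    qed
    also have "\<dots> \<le> 1 + F z" by simp
    finally show ?thesis .
  qed
  have "(\<integral>\<^sup>+z. ennreal (cmod (1 / (z - c))) \<partial>cgauss) \<le> (\<integral>\<^sup>+z. 1 + F z \<partial>cgauss)"
    by (rule nn_integral_mono_AE) (use AE_cgauss_neq[of c] bound in auto)
  also have "\<dots> = 1 + (\<Sum>k. ennreal (2 ^ Suc k) * emeasure cgauss (cball c (1 / 2 ^ k)))"
    unfolding F_def by (simp add: nn_integral_add nn_integral_suminf nn_integral_cmult cgauss.emeasure_space_1[simplified])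
  also have "\<dots> \<le> 1 + (\<Sum>k. ennreal (2 * (1 / 2) ^ k))"
  proof (intro add_left_mono suminf_le)
    fix k :: nat
    have "ennreal (2 ^ Suc k) * emeasure cgauss (cball c (1 / 2 ^ k)) \<le> ennreal (2 ^ Suc k) * ennreal ((1 / 2 ^ k)\<^sup>2)"
      by (intro mult_left_mono emeasure_cgauss_cball) auto
    also have "\<dots> = ennreal (2 * (1 / 2) ^ k)"
      by (simp add: power2_eq_square field_simps flip: ennreal_mult)
    finally show "ennreal (2 ^ Suc k) * emeasure cgauss (cball c (1 / 2 ^ k)) \<le> ennreal (2 * (1 / 2) ^ k)" .
  qed auto
  also have "(\<Sum>k. ennreal (2 * (1 / 2) ^ k)) = ennreal (\<Sum>k. 2 * (1 / 2) ^ k)"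
    by (intro suminf_ennreal2 summable_mult summable_geometric) auto
  also have "1 + \<dots> < \<infinity>" by simp
  finally show ?thesis by (intro integrableI_bounded) auto
qed

text \<open>By \<open>\<bar>z\<bar> \<le> exp (\<bar>z\<bar>\<^sup>2 / 2)\<close> the integral is at most that of \<open>exp (- \<bar>z\<bar>\<^sup>2 / 2) / pi\<close>, which scaling by
  \<open>sqrt 2\<close> turns into twice the total mass of the Gaussian.\<close>

lemma cgauss_integrable_id: "integrable cgauss (\<lambda>z. z)"
proof -
  have "(\<integral>\<^sup>+z. ennreal (cmod z) \<partial>cgauss) = (\<integral>\<^sup>+z. std_complex_normal_density z * ennreal (cmod z) \<partial>lborel)"
    unfolding cgauss_def by (rule nn_integral_density) auto
  also have "\<dots> \<le> (\<integral>\<^sup>+z. ennreal (exp (- (cmod z)\<^sup>2 / 2) / pi) \<partial>lborel)"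
  proof (rule nn_integral_mono)
    fix z :: complex
    have "cmod z \<le> 1 + (cmod z)\<^sup>2 / 2"
      using zero_le_power2[of "cmod z - 1"] by (simp add: power2_eq_square algebra_simps)
    also have "\<dots> \<le> exp ((cmod z)\<^sup>2 / 2)" by (rule exp_ge_add_one_self)
    finally have "exp (- (cmod z)\<^sup>2) * cmod z \<le> exp (- (cmod z)\<^sup>2) * exp ((cmod z)\<^sup>2 / 2)"
      by (intro mult_left_mono) auto
    also have "\<dots> = exp (- (cmod z)\<^sup>2 / 2)" by (simp flip: exp_add)
    finally show "std_complex_normal_density z * ennreal (cmod z) \<le> ennreal (exp (- (cmod z)\<^sup>2 / 2) / pi)"
      by (auto simp: std_complex_normal_density_def divide_right_mono intro!: ennreal_leI simp flip: ennreal_mult)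
  qed
  also have "\<dots> = (\<integral>\<^sup>+z. ennreal 2 * ennreal (exp (- (cmod (sqrt 2 *\<^sub>R z))\<^sup>2 / 2) / pi) \<partial>lborel)"
  proof -
    have "(\<integral>\<^sup>+z. ennreal (exp (- (cmod z)\<^sup>2 / 2) / pi) \<partial>(lborel :: complex measure))
      = (\<integral>\<^sup>+z. ennreal (exp (- (cmod z)\<^sup>2 / 2) / pi) \<partial>density (distr lborel borel (\<lambda>x. 0 + sqrt 2 *\<^sub>R x)) (\<lambda>_. \<bar>sqrt 2\<bar> ^ DIM(complex)))"
      by (subst (1) lborel_affine[of "sqrt 2" 0]) auto
    thus ?thesis by (simp add: nn_integral_density nn_integral_distr)
  qed
  also have "\<dots> = (\<integral>\<^sup>+z. ennreal 2 * std_complex_normal_density z \<partial>lborel)"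
    by (simp add: std_complex_normal_density_def power_mult_distrib)
  also have "\<dots> = ennreal 2 * (\<integral>\<^sup>+z. 1 \<partial>cgauss)"
    unfolding cgauss_def by (subst nn_integral_density) (auto simp: nn_integral_cmult)
  also have "\<dots> < \<infinity>" by (simp add: cgauss.emeasure_space_1[simplified])
  finally show ?thesis by (intro integrableI_bounded) auto
qed

lemma cgauss_mean_zero: "(\<integral>z. z \<partial>cgauss) = 0"
proof -
  have "(\<integral>z. z \<partial>cgauss) = (\<integral>z. z \<partial>distr cgauss borel (\<lambda>z. - 1 * z))"
    by (subst cgauss_rotate) auto
  also have "\<dots> = - (\<integral>z. z \<partial>cgauss)" by (subst integral_distr) auto
  finally show ?thesis by simp
qed

lemma cgauss_integrable_ratio:
  assumes "s > 0"
  shows "integrable cgauss (\<lambda>z. 1 / (of_real s * z - v))"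
    and "integrable cgauss (\<lambda>z. z / (of_real s * z - v))"
proof -
  have "integrable cgauss (\<lambda>z. (1 / of_real s) * (1 / (z - v / of_real s)))"
    by (intro integrable_mult_right cgauss_integrable_pole)
  also have "(\<lambda>z. (1 / of_real s) * (1 / (z - v / of_real s))) = (\<lambda>z. 1 / (of_real s * z - v))"
    using assms by (auto simp: fun_eq_iff field_simps)
  finally show 1: "integrable cgauss (\<lambda>z. 1 / (of_real s * z - v))" .
  have "integrable cgauss (\<lambda>z. 1 / of_real s + v / of_real s * (1 / (of_real s * z - v)))"
    using 1 by (intro Bochner_Integration.integrable_add integrable_mult_right) auto
  moreover have "AE z in cgauss. z / (of_real s * z - v) = 1 / of_real s + v / of_real s * (1 / (of_real s * z - v))"
    using AE_cgauss_neq[of "v / of_real s"]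
  proof eventually_elim
    case (elim z)
    hence "of_real s * z - v \<noteq> 0" using assms by (auto simp: field_simps)
    thus ?case using assms by (simp add: field_simps)
  qed
  ultimately show "integrable cgauss (\<lambda>z. z / (of_real s * z - v))"
    by (subst integrable_cong_AE[where g = "\<lambda>z. 1 / of_real s + v / of_real s * (1 / (of_real s * z - v))"]) auto
qed

text \<open>The integrand is first averaged over the phase of \<open>z\<close>, under which the Gaussian is invariant. Divided
  through by \<open>s\<close> and the direction of \<open>z\<close>, the average is a circle mean of a Cauchy factor over the
  circle of radius \<open>\<bar>z\<bar>\<close>, with value 1 if \<open>\<bar>v\<bar> < s \<bar>z\<bar>\<close> and 0 if \<open>\<bar>v\<bar> > s \<bar>z\<bar>\<close>.\<close>

lemma cgauss_mean_ratio:
  assumes s: "s > 0"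
  shows "(\<integral>z. of_real s * z / (of_real s * z - v) \<partial>cgauss) = of_real (exceed_prob v s)"
proof -
  define f where "f z = of_real s * z / (of_real s * z - v)" for z
  have fm [measurable]: "f \<in> borel_measurable borel" unfolding f_def by measurable
  have fi: "integrable cgauss f"
    using cgauss_integrable_ratio(2)[OF s, of v] unfolding f_def
    by (auto simp flip: times_divide_eq_right)
  interpret pair_sigma_finite cgauss unif_angle ..
  have rot: "integrable cgauss (\<lambda>z. f (cis t * z))" "(\<integral>z. f (cis t * z) \<partial>cgauss) = (\<integral>z. f z \<partial>cgauss)"
    "(\<integral>z. norm (f (cis t * z)) \<partial>cgauss) = (\<integral>z. norm (f z) \<partial>cgauss)" for t
  proof -
    have e: "distr cgauss borel ((*) (cis t)) = cgauss" by (rule cgauss_rotate) simp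
    show "integrable cgauss (\<lambda>z. f (cis t * z))"
      using fi by (subst (asm) e[symmetric], subst (asm) integrable_distr_eq) auto
    show "(\<integral>z. f (cis t * z) \<partial>cgauss) = (\<integral>z. f z \<partial>cgauss)"
      by (subst (2) e[symmetric], subst integral_distr) auto
    show "(\<integral>z. norm (f (cis t * z)) \<partial>cgauss) = (\<integral>z. norm (f z) \<partial>cgauss)"
      by (subst (2) e[symmetric], subst integral_distr) auto
  qed
  interpret Q: pair_sigma_finite unif_angle cgauss ..
  have int: "integrable (unif_angle \<Otimes>\<^sub>M cgauss) (\<lambda>(t, z). f (cis t * z))"
    by (intro Q.Fubini_integrable) (auto simp: rot)
  have "(\<integral>z. f z \<partial>cgauss) = (\<integral>t. \<integral>z. f (cis t * z) \<partial>cgauss \<partial>unif_angle)"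
    by (simp add: rot unif_angle.prob_space[simplified])
  also have "\<dots> = (\<integral>z. \<integral>t. f (cis t * z) \<partial>unif_angle \<partial>cgauss)"
    by (rule Q.Fubini_integral[OF int, symmetric])
  also have "\<dots> = (\<integral>z. indicator {z. cmod v < s * cmod z} z \<partial>cgauss)"
  proof (rule integral_cong_AE)
    show "AE z in cgauss. (\<integral>t. f (cis t * z) \<partial>unif_angle) = indicator {z. cmod v < s * cmod z} z"
      using AE_cgauss_norm_neq[of "cmod v / s"] AE_cgauss_neq[of 0]
    proof eventually_elim
      case (elim z)
      define \<rho> where "\<rho> = cmod z"
      have \<rho>: "\<rho> > 0" using elim by (simp add: \<rho>_def)
      have ne: "cmod (v / (of_real s * sgn z)) \<noteq> \<rho>"
        using elim s by (simp add: norm_divide norm_mult norm_sgn \<rho>_def)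
      have z: "z = of_real \<rho> * sgn z" unfolding \<rho>_def using elim
        by (simp add: sgn_div_norm scaleR_conv_of_real)
      have "f (cis t * z) = of_real \<rho> * cis t / (of_real \<rho> * cis t - v / (of_real s * sgn z))" for t
      proof -
        have u: "of_real s * sgn z \<noteq> 0" using s elim
          by (metis mult_eq_0_iff norm_sgn norm_zero of_real_eq_0_iff order_less_irrefl zero_neq_one)
        have "f (cis t * z) = (of_real s * sgn z) * (of_real \<rho> * cis t) / ((of_real s * sgn z) * (of_real \<rho> * cis t) - v)"
          unfolding f_def by (subst (1 2) z) (simp add: mult_ac)
        also have "\<dots> = (of_real s * sgn z) * (of_real \<rho> * cis t)
             / ((of_real s * sgn z) * (of_real \<rho> * cis t - v / (of_real s * sgn z)))"
          using u by (simp add: right_diff_distrib)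
        also have "\<dots> = of_real \<rho> * cis t / (of_real \<rho> * cis t - v / (of_real s * sgn z))"
          by (rule mult_divide_mult_cancel_left[OF u])
        finally show ?thesis .
      qed
      hence "(\<integral>t. f (cis t * z) \<partial>unif_angle)
         = (if cmod (v / (of_real s * sgn z)) < \<rho> then 1 else 0)"
        using circle_mean_cauchy_factor[OF \<rho> ne] by simp
      also have "cmod (v / (of_real s * sgn z)) < \<rho> \<longleftrightarrow> cmod v < s * cmod z"
        using elim s by (simp add: norm_divide norm_mult norm_sgn \<rho>_def field_simps)
      finally show ?case by (auto simp: indicator_def)
    qed
  qed measurable
  also have "\<dots> = of_real (exceed_prob v s)"
  proof -
    have "(indicator A z :: complex) = of_real (indicator A z :: real)" for A and z :: complex
      by (simp add: indicator_def)
    thus ?thesis by (simp add: exceed_prob_def)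
  qed
  finally show ?thesis unfolding f_def .
qed

end

section \<open>Linear combinations of independent Gaussians\<close>

lemma (in pair_sigma_finite) integral_product_functions:
  fixes f :: "_ \<Rightarrow> complex" and g :: "_ \<Rightarrow> complex"
  assumes f: "integrable M1 f" and g: "integrable M2 g"
  shows "integrable (M1 \<Otimes>\<^sub>M M2) (\<lambda>p. f (fst p) * g (snd p))"
    and "(\<integral>p. f (fst p) * g (snd p) \<partial>(M1 \<Otimes>\<^sub>M M2)) = (\<integral>x. f x \<partial>M1) * (\<integral>y. g y \<partial>M2)"
proof -
  have [measurable]: "f \<in> borel_measurable M1" "g \<in> borel_measurable M2"
    using f g by (simp_all add: borel_measurable_integrable)
  show int: "integrable (M1 \<Otimes>\<^sub>M M2) (\<lambda>p. f (fst p) * g (snd p))"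
  proof (rule Fubini_integrable)
    show "integrable M1 (\<lambda>x. \<integral>y. norm (f (fst (x, y)) * g (snd (x, y))) \<partial>M2)"
      using f by (simp add: norm_mult)
  qed (use g in auto)
  have "(\<integral>p. f (fst p) * g (snd p) \<partial>(M1 \<Otimes>\<^sub>M M2)) = (\<integral>x. \<integral>y. f x * g y \<partial>M2 \<partial>M1)"
    using integral_fst'[OF int] by simp
  thus "(\<integral>p. f (fst p) * g (snd p) \<partial>(M1 \<Otimes>\<^sub>M M2)) = (\<integral>x. f x \<partial>M1) * (\<integral>y. g y \<partial>M2)"
    by simp
qed

context
  assumes prob_cgauss: "prob_space cgauss"
begin

interpretation cgauss: prob_space cgauss by (rule prob_cgauss)
interpretation cgauss_pair: pair_sigma_finite cgauss cgauss ..

lemma exceed_prob_bounds: "0 \<le> exceed_prob v s" "exceed_prob v s \<le> 1"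
  by (simp_all add: exceed_prob_def)

text \<open>Continuity in \<open>s\<close> and the limit for large \<open>s\<close> are the same dominated convergence argument; only the
  limit event \<open>A\<close> differs.\<close>

lemma exceed_prob_tendsto_aux:
  assumes "AE z in cgauss. eventually (\<lambda>k. cmod v < s k * cmod z \<longleftrightarrow> z \<in> A) sequentially"
    and [measurable]: "A \<in> sets borel"
  shows "(\<lambda>k. exceed_prob v (s k)) \<longlonglongrightarrow> measure cgauss A"
proof -
  have "(\<lambda>k. \<integral>z. indicator {z. cmod v < s k * cmod z} z \<partial>cgauss) \<longlonglongrightarrow> (\<integral>z. indicator A z \<partial>cgauss :: real)"
  proof (rule integral_dominated_convergence[where w = "\<lambda>_. 1"])
    show "AE z in cgauss. (\<lambda>k. indicator {z. cmod v < s k * cmod z} z :: real) \<longlonglongrightarrow> indicator A z"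
      using assms(1)
    proof eventually_elim
      case (elim z)
      have "eventually (\<lambda>k. indicator {z. cmod v < s k * cmod z} z = (indicator A z :: real)) sequentially"
        using elim by eventually_elim (auto simp: indicator_def)
      thus ?case by (rule tendsto_eventually)
    qed
  qed (auto simp: indicator_def)
  thus ?thesis by (simp add: exceed_prob_def)
qed

lemma exceed_prob_tendsto:
  assumes s: "s \<longlonglongrightarrow> l" and l: "l > 0"
  shows "(\<lambda>k. exceed_prob v (s k)) \<longlonglongrightarrow> exceed_prob v l"
  unfolding exceed_prob_def[of v l]
proof (rule exceed_prob_tendsto_aux)
  show "AE z in cgauss. eventually (\<lambda>k. cmod v < s k * cmod z \<longleftrightarrow> z \<in> {z. cmod v < l * cmod z}) sequentially"
    using AE_cgauss_norm_neq[of "cmod v / l"]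
  proof eventually_elim
    case (elim z)
    have lim: "(\<lambda>k. s k * cmod z) \<longlonglongrightarrow> l * cmod z" by (intro tendsto_intros s)
    have "cmod v < l * cmod z \<or> cmod v > l * cmod z" using elim l by (auto simp: field_simps)
    thus ?case
    proof
      assume h: "cmod v < l * cmod z"
      from order_tendstoD(1)[OF lim h] show ?thesis by eventually_elim (use h in auto)
    next
      assume h: "cmod v > l * cmod z"
      from order_tendstoD(2)[OF lim h] show ?thesis by eventually_elim (use h in auto)
    qed
  qed
qed measurable

lemma exceed_prob_at_top:
  assumes s: "filterlim s at_top sequentially"
  shows "(\<lambda>k. exceed_prob v (s k)) \<longlonglongrightarrow> 1"
proof -
  have "(\<lambda>k. exceed_prob v (s k)) \<longlonglongrightarrow> measure cgauss UNIV"
  proof (rule exceed_prob_tendsto_aux)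
    show "AE z in cgauss. eventually (\<lambda>k. cmod v < s k * cmod z \<longleftrightarrow> z \<in> UNIV) sequentially"
      using AE_cgauss_neq[of 0]
    proof eventually_elim
      case (elim z)
      have "eventually (\<lambda>k. s k > cmod v / cmod z) sequentially"
        using s by (auto simp: filterlim_at_top_dense)
      thus ?case by eventually_elim (use elim in \<open>auto simp: field_simps\<close>)
    qed
  qed auto
  thus ?thesis by (simp add: cgauss.prob_space[simplified])
qed

lemma indep_linear_comb:
  fixes \<eta> :: "nat \<Rightarrow> 'a \<Rightarrow> complex"
  assumes P: "prob_space P"
    and ind: "prob_space.indep_vars P (\<lambda>_. borel) \<eta> UNIV"
    and A: "finite A" "i \<notin> A"
  shows "prob_space.indep_var P borel (\<eta> i) borel (\<lambda>\<omega>. \<Sum>j\<in>A. a j * \<eta> j \<omega>)"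
proof -
  interpret prob_space P by (rule P)
  have ind': "indep_vars (\<lambda>_. borel) \<eta> (insert i A)"
    by (rule indep_vars_subset[OF ind]) simp
  have "indep_var
    borel ((\<lambda>f. f i) \<circ> (\<lambda>\<omega>. restrict (\<lambda>i. \<eta> i \<omega>) {i}))
    borel ((\<lambda>f. \<Sum>j\<in>A. a j * f j) \<circ> (\<lambda>\<omega>. restrict (\<lambda>i. \<eta> i \<omega>) A))"
    using A by (intro indep_var_compose[OF indep_var_restrict[OF ind']]) auto
  also have "((\<lambda>f. f i) \<circ> (\<lambda>\<omega>. restrict (\<lambda>i. \<eta> i \<omega>) {i})) = \<eta> i"
    by auto
  also have "((\<lambda>f. \<Sum>j\<in>A. a j * f j) \<circ> (\<lambda>\<omega>. restrict (\<lambda>i. \<eta> i \<omega>) A)) = (\<lambda>\<omega>. \<Sum>j\<in>A. a j * \<eta> j \<omega>)"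
    by (auto cong: rev_conj_cong)
  finally show ?thesis .
qed

context
  fixes P :: "'a measure" and \<eta> :: "nat \<Rightarrow> 'a \<Rightarrow> complex"
  assumes P: "prob_space P"
    and ind: "prob_space.indep_vars P (\<lambda>_. borel) \<eta> UNIV"
    and law: "\<And>j. distr P borel (\<eta> j) = cgauss"
begin

interpretation prob_space P by (rule P)

lemma measurable_iid [measurable]: "\<eta> j \<in> borel_measurable P"
  using ind by (auto simp: indep_vars_def)

lemma joint_law:
  assumes A: "finite A" "i \<notin> A"
    and S: "distr P borel (\<lambda>\<omega>. \<Sum>j\<in>A. a j * \<eta> j \<omega>) = distr cgauss borel (\<lambda>z. of_real r * z)"
  shows "distr P (borel \<Otimes>\<^sub>M borel) (\<lambda>\<omega>. (\<eta> i \<omega>, \<Sum>j\<in>A. a j * \<eta> j \<omega>))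
     = distr (cgauss \<Otimes>\<^sub>M cgauss) (borel \<Otimes>\<^sub>M borel) (\<lambda>p. (fst p, of_real r * snd p))"
proof -
  have "distr P (borel \<Otimes>\<^sub>M borel) (\<lambda>\<omega>. (\<eta> i \<omega>, \<Sum>j\<in>A. a j * \<eta> j \<omega>))
     = distr P borel (\<eta> i) \<Otimes>\<^sub>M distr P borel (\<lambda>\<omega>. \<Sum>j\<in>A. a j * \<eta> j \<omega>)"
    using indep_linear_comb[OF P ind A, of a] by (simp add: indep_var_distribution_eq)
  also have "\<dots> = distr cgauss borel (\<lambda>z. z) \<Otimes>\<^sub>M distr cgauss borel (\<lambda>z. of_real r * z)"
    by (simp only: S law distr_id2 sets_cgauss)
  also have "\<dots> = distr (cgauss \<Otimes>\<^sub>M cgauss) (borel \<Otimes>\<^sub>M borel) (\<lambda>(x, y). (x, of_real r * y))"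
    by (rule pair_measure_distr)
       (auto intro!: prob_space_imp_sigma_finite cgauss.prob_space_distr)
  finally show ?thesis by (simp add: case_prod_beta')
qed

text \<open>By induction: adding one more independent summand to a multiple of a Gaussian gives, by planar
  rotation, a multiple of a single Gaussian again, and the squared coefficients add up.\<close>

lemma law_linear_comb:
  assumes "finite A"
  shows "distr P borel (\<lambda>\<omega>. \<Sum>j\<in>A. a j * \<eta> j \<omega>)
    = distr cgauss borel (\<lambda>z. of_real (sqrt (\<Sum>j\<in>A. (cmod (a j))\<^sup>2)) * z)"
  using assms
proof (induction A)
  case empty
  have "distr P borel (\<lambda>\<omega>. 0 :: complex) = distr cgauss borel (\<lambda>z. 0)"
    by (rule measure_eqI)
       (auto simp: emeasure_distr emeasure_space_1 cgauss.emeasure_space_1[simplified] indicator_def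
          vimage_def)
  thus ?case by simp
next
  case (insert i A)
  define r where "r = sqrt (\<Sum>j\<in>A. (cmod (a j))\<^sup>2)"
  define s where "s = sqrt (\<Sum>j\<in>insert i A. (cmod (a j))\<^sup>2)"
  have r2: "r\<^sup>2 = (\<Sum>j\<in>A. (cmod (a j))\<^sup>2)" unfolding r_def by (simp add: sum_nonneg)
  have s2: "s\<^sup>2 = (cmod (a i))\<^sup>2 + r\<^sup>2" unfolding s_def r2 using insert.hyps by (simp add: sum_nonneg)
  have "distr P borel (\<lambda>\<omega>. \<Sum>j\<in>insert i A. a j * \<eta> j \<omega>)
     = distr (distr P (borel \<Otimes>\<^sub>M borel) (\<lambda>\<omega>. (\<eta> i \<omega>, \<Sum>j\<in>A. a j * \<eta> j \<omega>))) borel (\<lambda>p. a i * fst p + snd p)"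
    using insert.hyps by (subst distr_distr) (auto simp: o_def)
  also have "\<dots> = distr (cgauss \<Otimes>\<^sub>M cgauss) borel (\<lambda>p. a i * fst p + of_real r * snd p)"
    unfolding joint_law[OF insert.hyps insert.IH] r_def[symmetric]
    by (subst distr_distr) (auto simp: o_def)
  also have "\<dots> = distr cgauss borel (\<lambda>z. of_real s * z)"
  proof (cases "s = 0")
    case True
    hence "(cmod (a i))\<^sup>2 + r\<^sup>2 = 0" using s2 by simp
    hence z: "a i = 0" "r = 0" by (simp_all add: add_nonneg_eq_0_iff)
    have "distr (cgauss \<Otimes>\<^sub>M cgauss) borel (\<lambda>p. of_real 0 * fst p) = distr cgauss borel (\<lambda>z. of_real 0 * z)"
      by (subst (2) cgauss.distr_pair_fst[of cgauss, symmetric], subst distr_distr) (auto simp: o_def)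
    thus ?thesis using True z by simp
  next
    case False
    have "(cmod (a i / of_real s))\<^sup>2 + (cmod (of_real r / of_real s))\<^sup>2 = 1"
      using False s2 by (auto simp add: norm_divide power_divide add_divide_distrib[symmetric])
    note lc = cgauss_linear_comb[OF prob_cgauss this]
    have "distr cgauss borel (\<lambda>z. of_real s * z) = distr (cgauss \<Otimes>\<^sub>M cgauss) borel
       (\<lambda>p. of_real s * (a i / of_real s * fst p + of_real r / of_real s * snd p))"
      by (subst (1) lc[symmetric], subst distr_distr) (auto simp: o_def)
    also have "(\<lambda>p. of_real s * (a i / of_real s * fst p + of_real r / of_real s * snd p))
        = (\<lambda>p. a i * fst p + of_real r * snd p)"
      using False by (simp add: fun_eq_iff field_simps)
    finally show ?thesis by simp
  qed
  finally show ?case unfolding s_def .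
qed

text \<open>With \<open>s = sqrt K\<close>, the sum is \<open>a\<^sub>i x + r y\<close> for independent standard Gaussians \<open>x = \<eta>\<^sub>i\<close> and \<open>y\<close>, and
  \<open>\<bar>a\<^sub>i\<bar>\<^sup>2 + r\<^sup>2 = s\<^sup>2\<close>. A rotation of the pair turns the sum into \<open>s x\<close> and \<open>\<eta>\<^sub>i\<close> into
  \<open>(cnj a\<^sub>i x - r y) / s\<close>. The term with \<open>y\<close> has mean zero by independence, and the other one is
  the mean of \<open>X / (X - v)\<close> with \<open>X = s x\<close>.\<close>

lemma expectation_coordinate_ratio:
  assumes i: "i \<le> n" and K: "K = (\<Sum>j\<le>n. (cmod (a j))\<^sup>2)" "K > 0"
  shows "integrable P (\<lambda>\<omega>. \<eta> i \<omega> / ((\<Sum>j\<le>n. a j * \<eta> j \<omega>) - v))"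
    and "(\<integral>\<omega>. \<eta> i \<omega> / ((\<Sum>j\<le>n. a j * \<eta> j \<omega>) - v) \<partial>P) = cnj (a i) / of_real K * of_real (exceed_prob v (sqrt K))"
proof -
  define A where "A = {..n} - {i}"
  have A: "finite A" "i \<notin> A" and ins: "{..n} = insert i A" using i by (auto simp: A_def)
  define r where "r = sqrt (\<Sum>j\<in>A. (cmod (a j))\<^sup>2)"
  define s where "s = sqrt K"
  have r2: "r\<^sup>2 = (\<Sum>j\<in>A. (cmod (a j))\<^sup>2)" unfolding r_def by (simp add: sum_nonneg)
  have s: "s > 0" and s2: "s\<^sup>2 = (cmod (a i))\<^sup>2 + r\<^sup>2" "s\<^sup>2 = K"
    unfolding s_def r2 using K A ins by simp_all
  define h where "h p = fst p / (a i * fst p + of_real r * snd p - v)" for p :: "complex \<times> complex"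
  have hm [measurable]: "h \<in> borel_measurable (borel \<Otimes>\<^sub>M borel)" unfolding h_def by measurable
  \<comment> \<open>the rotation whose inverse has first row \<open>(a i, r) / s\<close>\<close>
  define \<alpha> where "\<alpha> = cnj (a i) / of_real s"
  define \<beta> where "\<beta> = - complex_of_real (r / s)"
  have "(cmod \<alpha>)\<^sup>2 + (cmod \<beta>)\<^sup>2 = 1"
    using s s2 unfolding \<alpha>_def \<beta>_def norm_minus_cancel norm_of_real
    by (auto simp add: norm_divide power_divide add_divide_distrib[symmetric])
  note rot = cgauss_planar_rotation[OF prob_cgauss this]
  have rm [measurable]: "planar_rotation \<alpha> \<beta> \<in> measurable (cgauss \<Otimes>\<^sub>M cgauss) (borel \<Otimes>\<^sub>M borel)"
    unfolding planar_rotation_def by measurable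
  define f where "f p = cnj (a i) / of_real s * (fst p / (of_real s * fst p - v) * 1)
      - of_real (r / s) * (1 / (of_real s * fst p - v) * snd p)" for p :: "complex \<times> complex"
  have hf: "h (planar_rotation \<alpha> \<beta> p) = f p" for p
  proof -
    have ss: "of_real s * of_real s = a i * cnj (a i) + of_real r * of_real r"
      using s2(1) complex_norm_square[of "a i"] by (metis of_real_add of_real_mult power2_eq_square)
    have "a i * fst (planar_rotation \<alpha> \<beta> p) + of_real r * snd (planar_rotation \<alpha> \<beta> p)
      = (a i * cnj (a i) + of_real r * of_real r) / of_real s * fst p"
      unfolding planar_rotation_def \<alpha>_def \<beta>_def using s by (simp add: field_simps)
    also have "\<dots> = of_real s * fst p" using s by (simp flip: ss)
    finally show ?thesis unfolding h_def f_def
      by (simp add: planar_rotation_def \<alpha>_def \<beta>_def diff_divide_distrib)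
  qed
  note I1 = cgauss_pair.integral_product_functions[OF cgauss_integrable_ratio(2)[OF prob_cgauss s, of v]
      cgauss.integrable_const[of 1]]
  note I2 = cgauss_pair.integral_product_functions[OF cgauss_integrable_ratio(1)[OF prob_cgauss s, of v]
      cgauss_integrable_id[OF prob_cgauss]]
  have fint: "integrable (cgauss \<Otimes>\<^sub>M cgauss) f"
    unfolding f_def by (intro Bochner_Integration.integrable_diff integrable_mult_right I1 I2)
  have "(\<integral>z. z / (of_real s * z - v) \<partial>cgauss) = of_real (exceed_prob v s) / of_real s"
    using cgauss_mean_ratio[OF prob_cgauss s, of v] s
    by (simp add: times_divide_eq_right[symmetric] del: times_divide_eq_right) (simp add: field_simps)
  note mean = this
  have "(\<integral>p. f p \<partial>(cgauss \<Otimes>\<^sub>M cgauss))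
     = cnj (a i) / of_real s * ((\<integral>z. z / (of_real s * z - v) \<partial>cgauss) * (\<integral>z. 1 \<partial>cgauss))
       - of_real (r / s) * ((\<integral>z. 1 / (of_real s * z - v) \<partial>cgauss) * (\<integral>z. z \<partial>cgauss))"
    unfolding f_def
    by (subst Bochner_Integration.integral_diff)
       ((intro integrable_mult_right I1(1) I2(1))+, simp only: integral_mult_right_zero I1(2) I2(2))
  hence fval: "(\<integral>p. f p \<partial>(cgauss \<Otimes>\<^sub>M cgauss)) = cnj (a i) / of_real K * of_real (exceed_prob v s)"
    by (simp add: mean cgauss_mean_zero[OF prob_cgauss] cgauss.prob_space[simplified]
      power2_eq_square flip: s2(2))
  have hint: "integrable (cgauss \<Otimes>\<^sub>M cgauss) h" "(\<integral>p. h p \<partial>(cgauss \<Otimes>\<^sub>M cgauss)) = (\<integral>p. f p \<partial>(cgauss \<Otimes>\<^sub>M cgauss))"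
  proof -
    show "integrable (cgauss \<Otimes>\<^sub>M cgauss) h"
      by (subst rot[symmetric], subst integrable_distr_eq) (auto simp: hf fint)
    show "(\<integral>p. h p \<partial>(cgauss \<Otimes>\<^sub>M cgauss)) = (\<integral>p. f p \<partial>(cgauss \<Otimes>\<^sub>M cgauss))"
      by (subst rot[symmetric], subst integral_distr) (auto simp: hf)
  qed
  define g where "g p = fst p / (a i * fst p + snd p - v)" for p :: "complex \<times> complex"
  have gm [measurable]: "g \<in> borel_measurable (borel \<Otimes>\<^sub>M borel)" unfolding g_def by measurable
  have eq: "\<eta> i \<omega> / ((\<Sum>j\<le>n. a j * \<eta> j \<omega>) - v) = g (\<eta> i \<omega>, \<Sum>j\<in>A. a j * \<eta> j \<omega>)" for \<omega>
    using A by (simp add: g_def ins)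
  have gh: "g (fst p, of_real r * snd p) = h p" for p by (simp add: g_def h_def)
  note jl = joint_law[OF A law_linear_comb[OF A(1)], of a, folded r_def]
  have "integrable (distr P (borel \<Otimes>\<^sub>M borel) (\<lambda>\<omega>. (\<eta> i \<omega>, \<Sum>j\<in>A. a j * \<eta> j \<omega>))) g"
    unfolding jl by (subst integrable_distr_eq) (auto simp: gh hint)
  thus "integrable P (\<lambda>\<omega>. \<eta> i \<omega> / ((\<Sum>j\<le>n. a j * \<eta> j \<omega>) - v))"
    unfolding eq by (subst (asm) integrable_distr_eq) auto
  have "(\<integral>\<omega>. \<eta> i \<omega> / ((\<Sum>j\<le>n. a j * \<eta> j \<omega>) - v) \<partial>P)
     = (\<integral>p. g p \<partial>distr P (borel \<Otimes>\<^sub>M borel) (\<lambda>\<omega>. (\<eta> i \<omega>, \<Sum>j\<in>A. a j * \<eta> j \<omega>)))"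
    unfolding eq by (subst integral_distr) auto
  also have "\<dots> = (\<integral>p. h p \<partial>(cgauss \<Otimes>\<^sub>M cgauss))"
    unfolding jl by (subst integral_distr) (auto simp: gh)
  finally show "(\<integral>\<omega>. \<eta> i \<omega> / ((\<Sum>j\<le>n. a j * \<eta> j \<omega>) - v) \<partial>P)
      = cnj (a i) / of_real K * of_real (exceed_prob v (sqrt K))"
    unfolding hint(2) fval s_def .
qed

lemma expectation_linear_ratio:
  assumes K: "K = (\<Sum>j\<le>n. (cmod (a j))\<^sup>2)" "K > 0"
  shows "integrable P (\<lambda>\<omega>. (\<Sum>j\<le>n. b j * \<eta> j \<omega>) / ((\<Sum>j\<le>n. a j * \<eta> j \<omega>) - v))"
    and "(\<integral>\<omega>. (\<Sum>j\<le>n. b j * \<eta> j \<omega>) / ((\<Sum>j\<le>n. a j * \<eta> j \<omega>) - v) \<partial>P)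
      = (\<Sum>j\<le>n. b j * cnj (a j)) / of_real K * of_real (exceed_prob v (sqrt K))"
proof -
  have eq: "(\<Sum>j\<le>n. b j * \<eta> j \<omega>) / ((\<Sum>j\<le>n. a j * \<eta> j \<omega>) - v)
      = (\<Sum>i\<le>n. b i * (\<eta> i \<omega> / ((\<Sum>j\<le>n. a j * \<eta> j \<omega>) - v)))" for \<omega>
    by (simp add: sum_divide_distrib)
  note E = expectation_coordinate_ratio[OF _ K, of _ v]
  show "integrable P (\<lambda>\<omega>. (\<Sum>j\<le>n. b j * \<eta> j \<omega>) / ((\<Sum>j\<le>n. a j * \<eta> j \<omega>) - v))"
    unfolding eq by (intro Bochner_Integration.integrable_sum integrable_mult_right E) auto
  have "(\<integral>\<omega>. (\<Sum>j\<le>n. b j * \<eta> j \<omega>) / ((\<Sum>j\<le>n. a j * \<eta> j \<omega>) - v) \<partial>P)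
     = (\<Sum>i\<le>n. \<integral>\<omega>. b i * (\<eta> i \<omega> / ((\<Sum>j\<le>n. a j * \<eta> j \<omega>) - v)) \<partial>P)"
    unfolding eq by (intro Bochner_Integration.integral_sum integrable_mult_right E) auto
  also have "\<dots> = (\<Sum>i\<le>n. b i * (cnj (a i) / of_real K * of_real (exceed_prob v (sqrt K))))"
    by (intro sum.cong refl) (simp only: integral_mult_right_zero E atMost_iff)
  also have "\<dots> = (\<Sum>j\<le>n. b j * cnj (a j)) / of_real K * of_real (exceed_prob v (sqrt K))"
    by (simp add: sum_distrib_right sum_divide_distrib mult.assoc)
  finally show "(\<integral>\<omega>. (\<Sum>j\<le>n. b j * \<eta> j \<omega>) / ((\<Sum>j\<le>n. a j * \<eta> j \<omega>) - v) \<partial>P)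
      = (\<Sum>j\<le>n. b j * cnj (a j)) / of_real K * of_real (exceed_prob v (sqrt K))" .
qed

end

end

section \<open>Orthonormal polynomials and their reproducing kernel\<close>

definition circle_inner :: "real measure \<Rightarrow> complex poly \<Rightarrow> complex poly \<Rightarrow> complex" where
  "circle_inner \<mu> p q = (LINT t|\<mu>. poly p (cis t) * cnj (poly q (cis t)))"

text \<open>The polynomial \<open>z ^ n * cnj (p (1 / cnj z))\<close> for \<open>p\<close> of degree at most \<open>n\<close>. In contrast, \<open>reflect_poly\<close>
  reverses with respect to the degree of \<open>p\<close> itself; a single \<open>n\<close> for all polynomials is
  what makes reversal an antilinear isometry.\<close>

definition n_reverse :: "nat \<Rightarrow> complex poly \<Rightarrow> complex poly" where
  "n_reverse n p = (\<Sum>i\<le>n. monom (cnj (coeff p i)) (n - i))"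

lemma coeff_n_reverse: "coeff (n_reverse n p) k = (if k \<le> n then cnj (coeff p (n - k)) else 0)"
proof -
  have "coeff (n_reverse n p) k = (\<Sum>i\<le>n. if n - i = k then cnj (coeff p i) else 0)"
    by (simp add: n_reverse_def coeff_sum)
  also have "\<dots> = (\<Sum>i\<le>n. if i = n - k \<and> k \<le> n then cnj (coeff p i) else 0)"
    by (intro sum.cong) auto
  also have "\<dots> = (if k \<le> n then cnj (coeff p (n - k)) else 0)"
    by (cases "k \<le> n") auto
  finally show ?thesis .
qed

lemma degree_n_reverse: "degree (n_reverse n p) \<le> n"
  by (rule degree_le) (simp add: coeff_n_reverse)

lemma n_reverse_n_reverse: "degree p \<le> n \<Longrightarrow> n_reverse n (n_reverse n p) = p"
  by (rule poly_eqI) (auto simp: coeff_n_reverse coeff_eq_0)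

lemma n_reverse_sum_smult:
  "n_reverse n (\<Sum>k\<in>A. smult (c k) (f k)) = (\<Sum>k\<in>A. smult (cnj (c k)) (n_reverse n (f k)))"
  by (rule poly_eqI) (simp add: coeff_n_reverse coeff_sum)

lemma pderiv_sum: "pderiv (\<Sum>k\<in>A. f k) = (\<Sum>k\<in>A. pderiv (f k))"
  by (induction A rule: infinite_finite_induct) (simp_all add: pderiv_add)

text \<open>On the unit circle reversal preserves the modulus, and it turns the logarithmic derivative
  \<open>z p' / p\<close> into \<open>n\<close> minus its conjugate.\<close>

lemma poly_n_reverse_circle:
  assumes z: "cmod z = 1" and p: "degree p \<le> n"
  shows "poly (n_reverse n p) z = z ^ n * cnj (poly p z)"
    and "z * poly (pderiv (n_reverse n p)) z
      = of_nat n * poly (n_reverse n p) z - z ^ n * cnj (z * poly (pderiv p) z)"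
proof -
  have zc: "z * cnj z = 1" using z by (simp flip: complex_norm_square)
  have pow: "z ^ (n - i) = z ^ n * cnj z ^ i" if "i \<le> n" for i
  proof -
    have "z ^ n * cnj z ^ i = z ^ (n - i) * (z * cnj z) ^ i"
      using that by (simp add: power_mult_distrib flip: power_add mult.assoc)
    thus ?thesis by (simp add: zc)
  qed
  have pm: "p = (\<Sum>i\<le>n. monom (coeff p i) i)"
    using poly_as_sum_of_monoms'[OF p] by simp
  have p': "poly p x = (\<Sum>i\<le>n. coeff p i * x ^ i)" for x
    by (subst pm) (simp add: poly_sum poly_monom)
  show "poly (n_reverse n p) z = z ^ n * cnj (poly p z)"
    by (simp add: p' n_reverse_def poly_sum poly_monom pow sum_distrib_left mult_ac)
  have zmon: "z * poly (pderiv (monom c k)) z = of_nat k * c * z ^ k" for c k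
    by (cases k) (simp_all add: pderiv_monom poly_monom mult_ac)
  have d: "z * poly (pderiv p) z = (\<Sum>i\<le>n. of_nat i * coeff p i * z ^ i)"
    by (subst pm) (simp add: pderiv_sum poly_sum sum_distrib_left zmon)
  have "z * poly (pderiv (n_reverse n p)) z = (\<Sum>i\<le>n. of_nat (n - i) * cnj (coeff p i) * z ^ (n - i))"
    by (simp add: n_reverse_def pderiv_sum poly_sum sum_distrib_left zmon)
  also have "\<dots> = (\<Sum>i\<le>n. of_nat n * (cnj (coeff p i) * z ^ (n - i))
       - z ^ n * (of_nat i * cnj (coeff p i) * cnj z ^ i))"
    by (intro sum.cong) (auto simp: of_nat_diff pow algebra_simps)
  also have "\<dots> = of_nat n * poly (n_reverse n p) z - z ^ n * cnj (z * poly (pderiv p) z)"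
    by (simp add: d n_reverse_def poly_sum poly_monom sum_subtractf sum_distrib_left)
  finally show "z * poly (pderiv (n_reverse n p)) z
      = of_nat n * poly (n_reverse n p) z - z ^ n * cnj (z * poly (pderiv p) z)" .
qed

text \<open>The diagonal of the Christoffel--Darboux kernel.\<close>

definition kernel :: "(nat \<Rightarrow> complex poly) \<Rightarrow> nat \<Rightarrow> complex \<Rightarrow> real" where
  "kernel \<phi> n z = (\<Sum>j\<le>n. (cmod (poly (\<phi> j) z))\<^sup>2)"

context
  fixes \<mu> :: "real measure" and \<phi> :: "nat \<Rightarrow> complex poly"
  assumes circ: "circle_prob_measure \<mu>" and orth: "orthonormal_polys \<mu> \<phi>"
begin

lemma circle_prob_space: "prob_space \<mu>" and circle_sets: "sets \<mu> = sets borel_arc"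
  using circ by (auto simp: circle_prob_measure_def)

lemma circle_measurable:
  assumes "f \<in> borel_measurable borel"
  shows "f \<in> borel_measurable \<mu>"
proof -
  have "f \<in> borel_measurable borel_arc"
    unfolding borel_arc_def by (rule measurable_restrict_space1[OF assms])
  thus ?thesis using circle_sets measurable_cong_sets by blast
qed

lemma circle_poly_integrable:
  "integrable \<mu> (\<lambda>t. poly p (cis t) * cnj (poly q (cis t)))"
proof -
  interpret prob_space \<mu> by (rule circle_prob_space)
  have "continuous_on (sphere 0 1) (\<lambda>z. poly p z * cnj (poly q z))"
    by (intro continuous_intros)
  hence "bounded ((\<lambda>z. poly p z * cnj (poly q z)) ` sphere 0 1)"
    by (intro compact_imp_bounded compact_continuous_image) auto
  then obtain B where B: "\<forall>z\<in>sphere 0 1. cmod (poly p z * cnj (poly q z)) \<le> B"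
    unfolding bounded_iff by auto
  have "(\<lambda>t. poly p (cis t) * cnj (poly q (cis t))) \<in> borel_measurable \<mu>"
    by (intro circle_measurable borel_measurable_continuous_onI continuous_intros)
  thus ?thesis by (intro integrable_const_bound[of _ B]) (use B in auto)
qed

lemma circle_inner_cnj: "circle_inner \<mu> q p = cnj (circle_inner \<mu> p q)"
  unfolding circle_inner_def
  by (simp add: mult.commute flip: Bochner_Integration.integral_cnj)

lemma circle_inner_sum_left:
  "circle_inner \<mu> (\<Sum>k\<in>A. smult (c k) (f k)) q = (\<Sum>k\<in>A. c k * circle_inner \<mu> (f k) q)"
proof -
  have "circle_inner \<mu> (\<Sum>k\<in>A. smult (c k) (f k)) q
     = (LINT t|\<mu>. (\<Sum>k\<in>A. c k * (poly (f k) (cis t) * cnj (poly q (cis t)))))"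
    by (simp add: circle_inner_def poly_sum sum_distrib_right mult.assoc)
  also have "\<dots> = (\<Sum>k\<in>A. LINT t|\<mu>. c k * (poly (f k) (cis t) * cnj (poly q (cis t))))"
    by (intro Bochner_Integration.integral_sum integrable_mult_right circle_poly_integrable)
  also have "\<dots> = (\<Sum>k\<in>A. c k * circle_inner \<mu> (f k) q)"
    unfolding circle_inner_def by (simp only: integral_mult_right_zero)
  finally show ?thesis .
qed

lemma circle_inner_n_reverse:
  assumes "degree p \<le> n" "degree q \<le> n"
  shows "circle_inner \<mu> (n_reverse n p) (n_reverse n q) = circle_inner \<mu> q p"
  unfolding circle_inner_def
proof (intro Bochner_Integration.integral_cong refl)
  fix t
  have "cis t ^ n * cnj (cis t ^ n) = 1" by (simp add: cis_cnj cis_mult flip: power_mult_distrib)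
  thus "poly (n_reverse n p) (cis t) * cnj (poly (n_reverse n q) (cis t))
      = poly q (cis t) * cnj (poly p (cis t))"
    using assms by (simp add: poly_n_reverse_circle(1) mult_ac del: complex_cnj_power)
qed

lemma orth_inner: "circle_inner \<mu> (\<phi> j) (\<phi> k) = (if j = k then 1 else 0)"
  using orth by (simp add: orthonormal_polys_def circle_inner_def)

lemma orth_degree: "degree (\<phi> j) = j" and orth_lead: "lead_coeff (\<phi> j) \<noteq> 0"
  using orth unfolding orthonormal_polys_def kappa_def
  by (blast, metis less_irrefl zero_complex.sel(1))

lemma orth_expansion:
  assumes "degree p \<le> n"
  shows "p = (\<Sum>j\<le>n. smult (circle_inner \<mu> p (\<phi> j)) (\<phi> j))"
proof -
  have "\<exists>c. p = (\<Sum>j\<le>n. smult (c j) (\<phi> j))"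
    using assms
  proof (induction n arbitrary: p)
    case 0
    have "\<phi> 0 = [:coeff (\<phi> 0) 0:]" "p = [:coeff p 0:]" 
      using 0 orth_degree[of 0] by (simp_all add: degree_0_id)
    moreover have "coeff (\<phi> 0) 0 \<noteq> 0" using orth_lead[of 0] orth_degree[of 0] by simp
    ultimately have "p = smult (coeff p 0 / coeff (\<phi> 0) 0) (\<phi> 0)"
      by (metis nonzero_mult_div_cancel_left mult.commute smult_pCons smult_0_right times_divide_eq_left)
    thus ?case by (intro exI[of _ "\<lambda>_. coeff p 0 / coeff (\<phi> 0) 0"]) simp
  next
    case (Suc n)
    define d where "d = coeff p (Suc n) / coeff (\<phi> (Suc n)) (Suc n)"
    have nz: "coeff (\<phi> (Suc n)) (Suc n) \<noteq> 0" using orth_lead[of "Suc n"] orth_degree[of "Suc n"] by simp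
    have "degree (p - smult d (\<phi> (Suc n))) \<le> n"
    proof (rule degree_le, safe)
      fix i assume "n < i"
      show "coeff (p - smult d (\<phi> (Suc n))) i = 0"
      proof (cases "i = Suc n")
        case True thus ?thesis using nz by (simp add: d_def)
      next
        case False
        hence "i > Suc n" using \<open>n < i\<close> by simp
        thus ?thesis using Suc.prems orth_degree[of "Suc n"] by (simp add: coeff_eq_0)
      qed
    qed
    from Suc.IH[OF this] obtain c where c: "p - smult d (\<phi> (Suc n)) = (\<Sum>j\<le>n. smult (c j) (\<phi> j))" by blast
    have "p = (\<Sum>j\<le>Suc n. smult ((c(Suc n := d)) j) (\<phi> j))"
      using c by (simp add: diff_eq_eq)
    thus ?case by blast
  qed
  then obtain c where c: "p = (\<Sum>j\<le>n. smult (c j) (\<phi> j))" by blast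
  have "circle_inner \<mu> p (\<phi> j) = c j" if "j \<le> n" for j
    unfolding c circle_inner_sum_left using that by (simp add: orth_inner if_distrib cong: if_cong)
  thus ?thesis using c by simp
qed

text \<open>The kernel does not depend on the choice of an orthonormal basis, and the reversed polynomials form
  one. The expansion coefficients \<open>u\<close> of the reversed basis in the original one also invert the change
  of basis, because reversal is an isometric involution. The functional \<open>L\<close> is general so that the first
  argument of the kernel can be differentiated.\<close>

lemma kernel_n_reverse:
  fixes L :: "complex poly \<Rightarrow> complex"
  assumes L: "\<And>(c :: nat \<Rightarrow> complex) f. L (\<Sum>k\<le>n. smult (c k) (f k)) = (\<Sum>k\<le>n. c k * L (f k))"
  shows "(\<Sum>j\<le>n. L (\<phi> j) * cnj (poly (\<phi> j) z))
    = (\<Sum>k\<le>n. L (n_reverse n (\<phi> k)) * cnj (poly (n_reverse n (\<phi> k)) z))"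
proof -
  define u where "u k j = circle_inner \<mu> (n_reverse n (\<phi> k)) (\<phi> j)" for k j
  have rev: "n_reverse n (\<phi> k) = (\<Sum>j\<le>n. smult (u k j) (\<phi> j))" for k
    unfolding u_def by (rule orth_expansion) (rule degree_n_reverse)
  have phi: "\<phi> j = (\<Sum>k\<le>n. smult (cnj (u k j)) (n_reverse n (\<phi> k)))" if j: "j \<le> n" for j
  proof -
    have dj: "degree (\<phi> j) \<le> n" using j by (simp add: orth_degree)
    have "\<phi> j = n_reverse n (n_reverse n (\<phi> j))" using dj by (simp add: n_reverse_n_reverse)
    also have "\<dots> = n_reverse n (\<Sum>k\<le>n. smult (circle_inner \<mu> (n_reverse n (\<phi> j)) (\<phi> k)) (\<phi> k))"
      using orth_expansion[OF degree_n_reverse[of n "\<phi> j"]] by simp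
    also have "\<dots> = (\<Sum>k\<le>n. smult (cnj (circle_inner \<mu> (n_reverse n (\<phi> j)) (\<phi> k))) (n_reverse n (\<phi> k)))"
      by (rule n_reverse_sum_smult)
    also have "\<dots> = (\<Sum>k\<le>n. smult (cnj (u k j)) (n_reverse n (\<phi> k)))"
    proof (intro sum.cong refl)
      fix k assume "k \<in> {..n}"
      hence "degree (\<phi> k) \<le> n" by (simp add: orth_degree)
      hence "circle_inner \<mu> (n_reverse n (\<phi> j)) (\<phi> k) = u k j"
        unfolding u_def
        using circle_inner_n_reverse[OF degree_n_reverse[of n "\<phi> k"] dj]
        by (simp add: n_reverse_n_reverse) (metis circle_inner_n_reverse degree_n_reverse dj n_reverse_n_reverse)
      thus "smult (cnj (circle_inner \<mu> (n_reverse n (\<phi> j)) (\<phi> k))) (n_reverse n (\<phi> k))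
        = smult (cnj (u k j)) (n_reverse n (\<phi> k))" by simp
    qed
    finally show ?thesis .
  qed
  have "(\<Sum>j\<le>n. L (\<phi> j) * cnj (poly (\<phi> j) z))
     = (\<Sum>j\<le>n. \<Sum>k\<le>n. cnj (u k j) * L (n_reverse n (\<phi> k)) * cnj (poly (\<phi> j) z))"
  proof (intro sum.cong refl)
    fix j assume "j \<in> {..n}"
    hence "L (\<phi> j) = (\<Sum>k\<le>n. cnj (u k j) * L (n_reverse n (\<phi> k)))"
      by (subst phi) (auto simp: L)
    thus "L (\<phi> j) * cnj (poly (\<phi> j) z) = (\<Sum>k\<le>n. cnj (u k j) * L (n_reverse n (\<phi> k)) * cnj (poly (\<phi> j) z))"
      by (simp add: sum_distrib_right)
  qed
  also have "\<dots> = (\<Sum>k\<le>n. \<Sum>j\<le>n. cnj (u k j) * L (n_reverse n (\<phi> k)) * cnj (poly (\<phi> j) z))"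
    by (rule sum.swap)
  also have "\<dots> = (\<Sum>k\<le>n. L (n_reverse n (\<phi> k)) * cnj (poly (n_reverse n (\<phi> k)) z))"
  proof (intro sum.cong refl)
    fix k
    have "poly (n_reverse n (\<phi> k)) z = (\<Sum>j\<le>n. u k j * poly (\<phi> j) z)"
      by (subst rev) (simp add: poly_sum)
    thus "(\<Sum>j\<le>n. cnj (u k j) * L (n_reverse n (\<phi> k)) * cnj (poly (\<phi> j) z))
       = L (n_reverse n (\<phi> k)) * cnj (poly (n_reverse n (\<phi> k)) z)"
      by (simp add: sum_distrib_left mult_ac)
  qed
  finally show ?thesis .
qed

text \<open>Let \<open>S\<close> be the sum. Computed in the reversed basis it is \<open>n K - cnj S\<close>, so its real part is \<open>n K / 2\<close>.\<close>

lemma Re_kernel_deriv: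
  assumes z: "cmod z = 1"
  shows "Re (\<Sum>j\<le>n. z * poly (pderiv (\<phi> j)) z * cnj (poly (\<phi> j) z)) = n / 2 * kernel \<phi> n z"
proof -
  let ?S = "\<Sum>j\<le>n. z * poly (pderiv (\<phi> j)) z * cnj (poly (\<phi> j) z)"
  have L: "z * poly (pderiv (\<Sum>k\<le>n. smult (c k) (f k))) z = (\<Sum>k\<le>n. c k * (z * poly (pderiv (f k)) z))"
    for c :: "nat \<Rightarrow> complex" and f
    by (simp add: pderiv_sum pderiv_smult poly_sum sum_distrib_left mult_ac)
  have zn: "z ^ n * cnj (z ^ n) = 1" 
    using z complex_norm_square[of "z ^ n"] by (simp add: norm_power)
  have "?S = (\<Sum>k\<le>n. z * poly (pderiv (n_reverse n (\<phi> k))) z * cnj (poly (n_reverse n (\<phi> k)) z))"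
    by (rule kernel_n_reverse[where L = "\<lambda>p. z * poly (pderiv p) z", OF L])
  also have "\<dots> = (\<Sum>k\<le>n. of_nat n * of_real ((cmod (poly (\<phi> k) z))\<^sup>2)
        - cnj (z * poly (pderiv (\<phi> k)) z * cnj (poly (\<phi> k) z)))"
  proof (intro sum.cong refl)
    fix k assume "k \<in> {..n}"
    hence d: "degree (\<phi> k) \<le> n" by (simp add: orth_degree)
    define A where "A = poly (\<phi> k) z"
    define B where "B = z * poly (pderiv (\<phi> k)) z"
    have "z * poly (pderiv (n_reverse n (\<phi> k))) z * cnj (poly (n_reverse n (\<phi> k)) z)
       = (z ^ n * cnj (z ^ n)) * (of_nat n * (A * cnj A) - cnj B * A)"
      unfolding poly_n_reverse_circle[OF z d] A_def[symmetric] B_def[symmetric]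
      by (simp add: algebra_simps)
    also have "\<dots> = of_nat n * of_real ((cmod A)\<^sup>2) - cnj (B * cnj A)"
      unfolding zn complex_norm_square by simp
    finally show "z * poly (pderiv (n_reverse n (\<phi> k))) z * cnj (poly (n_reverse n (\<phi> k)) z)
       = of_nat n * of_real ((cmod (poly (\<phi> k) z))\<^sup>2) - cnj (z * poly (pderiv (\<phi> k)) z * cnj (poly (\<phi> k) z))"
      unfolding A_def B_def .
  qed
  also have "\<dots> = of_real (n * kernel \<phi> n z) - cnj ?S"
    by (simp add: sum_subtractf kernel_def sum_distrib_left)
  finally have "Re ?S = Re (of_real (n * kernel \<phi> n z) - cnj ?S)"
    by (rule arg_cong)
  also have "\<dots> = n * kernel \<phi> n z - Re ?S"
    by (simp only: minus_complex.sel cnj.sel Re_complex_of_real)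
  finally have "Re ?S = n * kernel \<phi> n z - Re ?S" .
  thus ?thesis by simp
qed

text \<open>Half of the Christoffel extremal characterization: Cauchy--Schwarz applied to the orthonormal
  expansion of \<open>p\<close> at \<open>z\<close>.\<close>

lemma kernel_extremal:
  assumes p: "degree p \<le> n" "poly p z = 1"
  shows "1 \<le> Re (circle_inner \<mu> p p) * kernel \<phi> n z"
proof -
  define c where "c j = circle_inner \<mu> p (\<phi> j)" for j
  have e: "p = (\<Sum>j\<le>n. smult (c j) (\<phi> j))" unfolding c_def by (rule orth_expansion[OF p(1)])
  have "circle_inner \<mu> p p = (\<Sum>j\<le>n. c j * circle_inner \<mu> (\<phi> j) p)"
    by (subst (1) e) (rule circle_inner_sum_left)
  also have "\<dots> = (\<Sum>j\<le>n. of_real ((cmod (c j))\<^sup>2))"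
    unfolding complex_norm_square by (intro sum.cong refl) (simp add: c_def circle_inner_cnj[of "\<phi> _" p])
  finally have norm: "Re (circle_inner \<mu> p p) = (\<Sum>j\<le>n. (cmod (c j))\<^sup>2)" by simp
  have "1 = cmod (poly p z)" using p by simp
  also have "poly p z = (\<Sum>j\<le>n. c j * poly (\<phi> j) z)" by (subst e) (simp add: poly_sum)
  also have "cmod \<dots> \<le> (\<Sum>j\<le>n. cmod (c j) * cmod (poly (\<phi> j) z))"
    by (rule order_trans[OF norm_sum]) (simp add: norm_mult)
  finally have "1 \<le> (\<Sum>j\<le>n. cmod (c j) * cmod (poly (\<phi> j) z))" .
  hence "1 \<le> (\<Sum>j\<le>n. cmod (c j) * cmod (poly (\<phi> j) z))\<^sup>2" by (rule one_le_power)
  also have "\<dots> \<le> (\<Sum>j\<le>n. (cmod (c j))\<^sup>2) * (\<Sum>j\<le>n. (cmod (poly (\<phi> j) z))\<^sup>2)"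
    by (rule Cauchy_Schwarz_ineq_sum)
  finally show ?thesis unfolding norm kernel_def .
qed

lemma kernel_mono: "m \<le> n \<Longrightarrow> kernel \<phi> m z \<le> kernel \<phi> n z"
  unfolding kernel_def by (intro sum_mono2) auto

lemma kernel_pos: "kernel \<phi> n z > 0"
proof -
  have "\<phi> 0 = [:coeff (\<phi> 0) 0:]" "coeff (\<phi> 0) 0 \<noteq> 0"
    using orth_lead[of 0] orth_degree[of 0] by (simp_all add: degree_0_id)
  hence "poly (\<phi> 0) z \<noteq> 0" by (metis mult_zero_right add_0_right poly_pCons poly_0)
  hence "0 < kernel \<phi> 0 z" by (simp add: kernel_def)
  also have "\<dots> \<le> kernel \<phi> n z" by (rule kernel_mono) simp
  finally show ?thesis .
qed

text \<open>As test polynomials serve the powers of \<open>l(x) = (1 + cnj z x) / 2\<close>: on the circle \<open>\<bar>l\<bar>\<close> is 1 at \<open>z\<close> and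
  less than 1 elsewhere, so their norms tend to zero by dominated convergence.\<close>

lemma kernel_at_top:
  assumes z: "cmod z = 1" and no_atom: "AE t in \<mu>. cis t \<noteq> z"
  shows "filterlim (\<lambda>n. kernel \<phi> n z) at_top sequentially"
proof -
  interpret prob_space \<mu> by (rule circle_prob_space)
  define l where "l = [:1/2, cnj z / 2:]"
  have lz: "poly l z = 1" using z complex_norm_square[of z] by (simp add: l_def)
  have lt: "poly l (cis t) = (1 + cnj z * cis t) / 2" for t by (simp add: l_def field_simps)
  have deg: "degree (l ^ n) \<le> n" for n
    using degree_power_le[of l n] by (rule order_trans) (simp add: l_def)
  have lim: "(\<lambda>n. \<integral>t. poly (l ^ n) (cis t) * cnj (poly (l ^ n) (cis t)) \<partial>\<mu>) \<longlonglongrightarrow> (\<integral>t. 0 \<partial>\<mu>)"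
  proof (rule integral_dominated_convergence[where w = "\<lambda>_. 1"])
    show "AE t in \<mu>. (\<lambda>n. poly (l ^ n) (cis t) * cnj (poly (l ^ n) (cis t))) \<longlonglongrightarrow> 0"
      using no_atom
    proof eventually_elim
      case (elim t)
      \<comment> \<open>equality in the triangle inequality would force \<open>cnj z * cis t = 1\<close>\<close>
      have "cmod (1 + cnj z * cis t) \<noteq> 2"
      proof
        assume "cmod (1 + cnj z * cis t) = 2"
        hence "norm (1 + cnj z * cis t) = norm (1::complex) + norm (cnj z * cis t)"
          using z by (simp add: norm_mult)
        hence "cnj z * cis t = 1" using z
          by (subst (asm) norm_triangle_eq) (simp add: norm_mult)
        hence "z * cnj z * cis t = z" by (simp only: mult.assoc mult_1_right)
        moreover have "z * cnj z = 1" using z by (simp flip: complex_norm_square)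
        ultimately show False using elim by (simp only: mult_1)
      qed
      moreover have "cmod (1 + cnj z * cis t) \<le> 1 + cmod (cnj z * cis t)"
        using norm_triangle_ineq[of 1 "cnj z * cis t"] by simp
      ultimately have "cmod (poly l (cis t)) < 1" using z by (simp add: lt norm_divide norm_mult)
      hence "(\<lambda>n. poly l (cis t) ^ n) \<longlonglongrightarrow> 0" by (rule LIMSEQ_power_zero)
      hence "(\<lambda>n. poly l (cis t) ^ n * cnj (poly l (cis t) ^ n)) \<longlonglongrightarrow> 0 * cnj 0"
        by (intro tendsto_mult tendsto_cnj)
      thus ?case by (simp add: poly_power)
    qed
    have "cmod (poly l (cis t)) \<le> 1" for t
      using norm_triangle_ineq[of 1 "cnj z * cis t"] z by (simp add: lt norm_divide norm_mult)
    thus "AE t in \<mu>. norm (poly (l ^ n) (cis t) * cnj (poly (l ^ n) (cis t))) \<le> 1" for n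
      by (intro AE_I2) (simp add: norm_mult norm_power poly_power power_le_one mult_le_one)
  qed (auto intro!: circle_measurable borel_measurable_continuous_onI continuous_intros)
  have lim0: "(\<lambda>n. Re (circle_inner \<mu> (l ^ n) (l ^ n))) \<longlonglongrightarrow> 0"
    using tendsto_Re[OF lim] unfolding circle_inner_def by simp
  show ?thesis
    unfolding filterlim_at_top_gt[where c = 0]
  proof safe
    fix Z :: real assume Z: "Z > 0"
    have "eventually (\<lambda>n. Re (circle_inner \<mu> (l ^ n) (l ^ n)) < 1 / Z) sequentially"
      using order_tendstoD(2)[OF lim0, of "1 / Z"] Z by simp
    thus "eventually (\<lambda>n. Z \<le> kernel \<phi> n z) sequentially"
    proof eventually_elim
      case (elim n)
      have "1 \<le> Re (circle_inner \<mu> (l ^ n) (l ^ n)) * kernel \<phi> n z"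
        by (rule kernel_extremal[OF deg]) (simp add: lz poly_power)
      also have "\<dots> \<le> 1 / Z * kernel \<phi> n z"
        using elim kernel_pos[of n z] by (intro mult_right_mono) auto
      finally show ?case using Z by (simp add: field_simps)
    qed
  qed
qed

end

section \<open>The expected number of roots\<close>

lemma AE_lebesgue_arc_neq:
  assumes "circle_prob_measure \<mu>" "absolutely_continuous lebesgue_arc \<mu>"
  shows "AE t in \<mu>. cis t \<noteq> z"
proof (rule absolutely_continuous_AE[OF _ assms(2)])
  show "sets \<mu> = sets lebesgue_arc"
    using assms(1) by (simp add: circle_prob_measure_def borel_arc_def lebesgue_arc_def sets_restrict_space)
  show "AE t in lebesgue_arc. cis t \<noteq> z"
    unfolding lebesgue_arc_def using AE_cis_neq[of z] by (subst AE_restrict_space_iff) auto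
qed

lemma iid_cgauss:
  assumes P: "prob_space P" and iid: "iid_std_complex_normal P \<eta>"
  shows "prob_space cgauss" and "distr P borel (\<eta> j) = cgauss"
proof -
  interpret prob_space P by (rule P)
  have d: "distributed P lborel (\<eta> j) std_complex_normal_density" for j
    using iid by (simp add: iid_std_complex_normal_def)
  have m: "\<eta> j \<in> measurable P lborel" for j
    using distributed_measurable[OF d] .
  have l: "distr P lborel (\<eta> j) = cgauss" for j
    using distributed_distr_eq_density[OF d] by (simp add: cgauss_def)
  show "prob_space cgauss" using prob_space_distr[OF m[of 0]] by (simp add: l)
  have "distr P borel (\<eta> j) = distr P lborel (\<eta> j)" by (rule distr_cong) auto
  thus "distr P borel (\<eta> j) = cgauss" by (simp add: l)
qed

lemma poly_random_poly: "poly (random_poly \<phi> \<eta> n \<omega>) z = (\<Sum>j\<le>n. poly (\<phi> j) z * \<eta> j \<omega>)"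
  by (simp add: random_poly_def poly_sum mult.commute)

lemma log_deriv_re_random_poly:
  "log_deriv_re (random_poly \<phi> \<eta> n \<omega> - [:v:]) z
    = Re ((\<Sum>j\<le>n. z * poly (pderiv (\<phi> j)) z * \<eta> j \<omega>) / ((\<Sum>j\<le>n. poly (\<phi> j) z * \<eta> j \<omega>) - v))"
proof -
  have "z * poly (pderiv (random_poly \<phi> \<eta> n \<omega> - [:v:])) z = (\<Sum>j\<le>n. z * poly (pderiv (\<phi> j)) z * \<eta> j \<omega>)"
    by (simp add: random_poly_def pderiv_diff pderiv_sum pderiv_smult pderiv_pCons poly_sum sum_distrib_left mult_ac)
  thus ?thesis by (simp add: log_deriv_re_def poly_random_poly)
qed

lemma degree_random_poly:
  assumes "\<And>j. degree (\<phi> j) = j"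
  shows "degree (random_poly \<phi> \<eta> n \<omega> - [:v:]) \<le> n"
proof (rule degree_diff_le)
  show "degree (random_poly \<phi> \<eta> n \<omega>) \<le> n"
    unfolding random_poly_def using assms
    by (intro degree_sum_le) (auto intro: order_trans[OF degree_smult_le])
qed simp

text \<open>The expectation of \<open>Re (z \<Phi>\<^sub>n'(z) / (\<Phi>\<^sub>n(z) - v))\<close>.\<close>

definition root_density :: "(nat \<Rightarrow> complex poly) \<Rightarrow> complex \<Rightarrow> nat \<Rightarrow> complex \<Rightarrow> real" where
  "root_density \<phi> v n z = Re (\<Sum>j\<le>n. z * poly (pderiv (\<phi> j)) z * cnj (poly (\<phi> j) z)) / kernel \<phi> n z
     * exceed_prob v (sqrt (kernel \<phi> n z))"

context
  fixes \<mu> :: "real measure" and \<phi> :: "nat \<Rightarrow> complex poly"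
    and P :: "'a measure" and \<eta> :: "nat \<Rightarrow> 'a \<Rightarrow> complex"
  assumes circ: "circle_prob_measure \<mu>" and orth: "orthonormal_polys \<mu> \<phi>"
    and P: "prob_space P" and iid: "iid_std_complex_normal P \<eta>"
begin

interpretation prob_space P by (rule P)
interpretation pair: pair_sigma_finite P unif_angle ..

lemmas prob_cgauss = iid_cgauss(1)[OF P iid]

lemma iid_indep: "indep_vars (\<lambda>_. borel) \<eta> UNIV"
  using iid by (simp add: iid_std_complex_normal_def)

lemma iid_measurable [measurable]: "\<eta> j \<in> borel_measurable P"
  using iid_indep by (auto simp: indep_vars_def)

lemma measurable_exceed_prob [measurable]: "exceed_prob v \<in> borel_measurable borel"
proof -
  interpret cgauss: prob_space cgauss by (rule prob_cgauss)
  have "(\<lambda>s. \<integral>z. indicator {z. cmod v < s * cmod z} z \<partial>cgauss :: real) \<in> borel_measurable borel"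
    by measurable
  thus ?thesis by (simp add: exceed_prob_def[abs_def])
qed

lemma expectation_log_deriv_re:
  "(\<integral>\<omega>. log_deriv_re (random_poly \<phi> \<eta> n \<omega> - [:v:]) z \<partial>P) = root_density \<phi> v n z"
proof -
  note E = expectation_linear_ratio[OF prob_cgauss P iid_indep iid_cgauss(2)[OF P iid]
      kernel_def kernel_pos[OF circ orth]]
  show ?thesis
    unfolding log_deriv_re_random_poly root_density_def
    by (subst integral_Re[OF E(1)], subst E(2)) (simp add: Re_divide_of_real)
qed

lemma circle_mean_measurable [measurable]:
  "(\<lambda>p. log_deriv_re (random_poly \<phi> \<eta> n (fst p) - [:v:]) (of_real r * cis (snd p)))
     \<in> borel_measurable (P \<Otimes>\<^sub>M unif_angle)"
proof -
  have [measurable]: "poly q \<in> borel_measurable borel" for q :: "complex poly"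
    by (intro borel_measurable_continuous_onI continuous_intros)
  show ?thesis unfolding log_deriv_re_random_poly by measurable
qed

lemma expectation_circle_mean:
  fixes n :: nat and v :: complex
  assumes r: "r > 0"
  defines "J \<equiv> \<lambda>\<omega>. \<integral>t. log_deriv_re (random_poly \<phi> \<eta> n \<omega> - [:v:]) (of_real r * cis t) \<partial>unif_angle"
  shows "J \<in> borel_measurable P" and "\<bar>J \<omega>\<bar> \<le> n"
    and "(\<integral>\<omega>. J \<omega> \<partial>P) = (\<integral>t. root_density \<phi> v n (of_real r * cis t) \<partial>unif_angle)"
proof -
  let ?f = "\<lambda>\<omega> t. log_deriv_re (random_poly \<phi> \<eta> n \<omega> - [:v:]) (of_real r * cis t)"
  note m = circle_mean_measurable[of n v r]
  have m' [measurable]: "(\<lambda>(\<omega>, t). ?f \<omega> t) \<in> borel_measurable (P \<Otimes>\<^sub>M unif_angle)"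
    using m by (simp add: case_prod_beta')
  show "J \<in> borel_measurable P" unfolding J_def by measurable
  have absm [measurable]: "(\<lambda>\<omega>. \<integral>t. \<bar>?f \<omega> t\<bar> \<partial>unif_angle) \<in> borel_measurable P" by measurable
  have L1: "(\<integral>t. \<bar>?f \<omega> t\<bar> \<partial>unif_angle) \<le> n" for \<omega>
    using log_deriv_re_L1_bound(2)[OF r, of "random_poly \<phi> \<eta> n \<omega> - [:v:]"]
      degree_random_poly[OF orth_degree[OF circ orth], of \<eta> n \<omega> v] by linarith
  show "\<bar>J \<omega>\<bar> \<le> n"
    unfolding J_def using integral_abs_bound[of unif_angle "?f \<omega>"] L1[of \<omega>] by linarith
  have "integrable P (\<lambda>\<omega>. \<integral>t. norm (case (\<omega>, t) of (\<omega>, t) \<Rightarrow> ?f \<omega> t) \<partial>unif_angle)"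
    by (rule integrable_const_bound[of _ n]) (use L1 absm in auto)
  hence "integrable (P \<Otimes>\<^sub>M unif_angle) (\<lambda>(\<omega>, t). ?f \<omega> t)"
    by (intro pair.Fubini_integrable m') (auto intro!: log_deriv_re_L1_bound(1)[OF r])
  from pair.Fubini_integral[OF this] show "(\<integral>\<omega>. J \<omega> \<partial>P) = (\<integral>t. root_density \<phi> v n (of_real r * cis t) \<partial>unif_angle)"
    unfolding J_def by (simp add: expectation_log_deriv_re)
qed

lemma root_density_tendsto:
  assumes "x \<longlonglongrightarrow> z"
  shows "(\<lambda>k. root_density \<phi> v n (x k)) \<longlonglongrightarrow> root_density \<phi> v n z"
proof -
  have k: "(\<lambda>k. kernel \<phi> n (x k)) \<longlonglongrightarrow> kernel \<phi> n z"
    unfolding kernel_def by (intro tendsto_intros assms)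
  have "kernel \<phi> n z \<noteq> 0" using kernel_pos[OF circ orth, of n z] by simp
  thus ?thesis unfolding root_density_def
    by (intro tendsto_intros assms k exceed_prob_tendsto[OF prob_cgauss])
       (use kernel_pos[OF circ orth, of n z] in auto)
qed

lemma root_density_bounded:
  obtains B where "\<And>z. cmod z \<le> 1 \<Longrightarrow> \<bar>root_density \<phi> v n z\<bar> \<le> B"
proof -
  let ?A = "\<lambda>z. Re (\<Sum>j\<le>n. z * poly (pderiv (\<phi> j)) z * cnj (poly (\<phi> j) z)) / kernel \<phi> n z"
  have nz: "kernel \<phi> n z \<noteq> 0" for z using kernel_pos[OF circ orth, of n z] by simp
  have "continuous_on (cball 0 1) (kernel \<phi> n)"
    unfolding kernel_def by (intro continuous_intros)
  hence "continuous_on (cball 0 1) ?A"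
    by (intro continuous_intros) (auto simp: nz)
  hence "bounded (?A ` cball 0 1)"
    by (intro compact_imp_bounded compact_continuous_image) auto
  then obtain B where B: "\<forall>z\<in>cball 0 1. \<bar>?A z\<bar> \<le> B"
    unfolding bounded_iff by auto
  have "\<bar>root_density \<phi> v n z\<bar> \<le> B" if "cmod z \<le> 1" for z
  proof -
    have "\<bar>root_density \<phi> v n z\<bar> = \<bar>?A z\<bar> * exceed_prob v (sqrt (kernel \<phi> n z))"
      unfolding root_density_def abs_mult using exceed_prob_bounds[OF prob_cgauss] by simp
    also have "\<dots> \<le> \<bar>?A z\<bar> * 1"
      by (intro mult_left_mono exceed_prob_bounds[OF prob_cgauss]) auto
    also have "\<dots> \<le> B" using B that by auto
    finally show ?thesis .
  qed
  thus ?thesis by (rule that)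
qed

text \<open>The symmetry of the kernel under reversal makes the factor in front of the probability constant on the
  circle.\<close>

lemma root_density_circle:
  assumes "cmod z = 1"
  shows "root_density \<phi> v n z = n / 2 * exceed_prob v (sqrt (kernel \<phi> n z))"
  unfolding root_density_def Re_kernel_deriv[OF circ orth assms]
  using kernel_pos[OF circ orth, of n z] by simp

lemma measurable_kernel_cis [measurable]: "(\<lambda>t. kernel \<phi> n (cis t)) \<in> borel_measurable borel"
  unfolding kernel_def by (intro borel_measurable_continuous_onI continuous_intros)

text \<open>The circle means over radii \<open>r\<^sub>k\<close> below 1 tend to the root count and are bounded by \<open>n\<close>, so their
  expectations tend to the expected count; these expectations are circle means of a function that is
  continuous up to the unit circle.\<close>

theorem expectation_disk_roots:
  "(\<integral>\<omega>. real (disk_roots (random_poly \<phi> \<eta> n \<omega>) v) \<partial>P)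
     = n / 2 * (\<integral>t. exceed_prob v (sqrt (kernel \<phi> n (cis t))) \<partial>unif_angle)"
proof -
  define r where "r k = 1 - 1 / real (k + 2)" for k
  have r: "0 < r k" "r k < 1" for k by (simp_all add: r_def)
  have rlim: "r \<longlonglongrightarrow> 1" unfolding r_def by real_asymp
  define J where "J k \<omega> = (\<integral>t. log_deriv_re (random_poly \<phi> \<eta> n \<omega> - [:v:]) (of_real (r k) * cis t) \<partial>unif_angle)" for k \<omega>
  note EJ = expectation_circle_mean[OF r(1), where n = n and v = v, folded J_def]
  have Jlim: "(\<lambda>k. J k \<omega>) \<longlonglongrightarrow> real (disk_roots (random_poly \<phi> \<eta> n \<omega>) v)" for \<omega>
    unfolding J_def by (rule circle_mean_log_deriv_tendsto_disk_roots[OF r rlim])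
  have meas: "(\<lambda>\<omega>. real (disk_roots (random_poly \<phi> \<eta> n \<omega>) v)) \<in> borel_measurable P"
    by (rule borel_measurable_LIMSEQ_real[OF Jlim EJ(1)])
  have lim1: "(\<lambda>k. \<integral>\<omega>. J k \<omega> \<partial>P) \<longlonglongrightarrow> (\<integral>\<omega>. real (disk_roots (random_poly \<phi> \<eta> n \<omega>) v) \<partial>P)"
    by (rule integral_dominated_convergence[where w = "\<lambda>_. real n"])
       (use Jlim EJ meas in auto)
  obtain B where B: "\<And>z. cmod z \<le> 1 \<Longrightarrow> \<bar>root_density \<phi> v n z\<bar> \<le> B"
    using root_density_bounded[where v = v and n = n] by blast
  have rd_meas: "(\<lambda>t. root_density \<phi> v n (of_real s * cis t)) \<in> borel_measurable unif_angle" for s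
  proof -
    have "continuous_on UNIV (root_density \<phi> v n)"
      by (intro continuous_on_sequentiallyI root_density_tendsto) auto
    hence "continuous_on UNIV (\<lambda>t. root_density \<phi> v n (of_real s * cis t))"
      by (rule continuous_on_compose2) (auto intro!: continuous_intros)
    hence "(\<lambda>t. root_density \<phi> v n (of_real s * cis t)) \<in> borel_measurable borel"
      by (rule borel_measurable_continuous_onI)
    thus ?thesis by measurable
  qed
  have lim2: "(\<lambda>k. \<integral>\<omega>. J k \<omega> \<partial>P) \<longlonglongrightarrow> (\<integral>t. root_density \<phi> v n (cis t) \<partial>unif_angle)"
    unfolding EJ(3)
  proof (rule integral_dominated_convergence[where w = "\<lambda>_. B"])
    show "AE t in unif_angle. (\<lambda>k. root_density \<phi> v n (of_real (r k) * cis t)) \<longlonglongrightarrow> root_density \<phi> v n (cis t)"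
    proof (rule AE_I2)
      fix t
      have "(\<lambda>k. of_real (r k) * cis t) \<longlonglongrightarrow> of_real 1 * cis t"
        by (intro tendsto_intros rlim)
      from root_density_tendsto[OF this] show "(\<lambda>k. root_density \<phi> v n (of_real (r k) * cis t)) \<longlonglongrightarrow> root_density \<phi> v n (cis t)"
        by simp
    qed
    show "AE t in unif_angle. norm (root_density \<phi> v n (of_real (r k) * cis t)) \<le> B" for k
      using r[of k] by (intro AE_I2) (auto intro!: B simp: norm_mult)
  qed (use rd_meas[of 1] rd_meas in auto)
  have "(\<integral>\<omega>. real (disk_roots (random_poly \<phi> \<eta> n \<omega>) v) \<partial>P) = (\<integral>t. root_density \<phi> v n (cis t) \<partial>unif_angle)"
    by (rule LIMSEQ_unique[OF lim1 lim2])
  thus ?thesis by (simp add: root_density_circle)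
qed

end

theorem theorem7p1:
  fixes \<mu> :: "real measure"
    and w :: "complex \<Rightarrow> real"
    and \<phi> :: "nat \<Rightarrow> complex poly"
    and P :: "'a measure"
    and \<eta> :: "nat \<Rightarrow> 'a \<Rightarrow> complex"
    and v :: complex
  assumes "circle_prob_measure \<mu>"
    and "strictly_positive_measure \<mu>"
    and "absolutely_continuous lebesgue_arc \<mu>"
    and "stu_regular \<mu>"
    and "has_weight \<mu> w"
    and "\<forall>z\<in>sphere 0 1. w z > 0"
    and "continuous_on (sphere 0 1) w"
    and "orthonormal_polys \<mu> \<phi>"
    and "prob_space P"
    and "iid_std_complex_normal P \<eta>"
  shows "(\<lambda>n. prob_space.expectation P
            (\<lambda>\<omega>. real (disk_roots (random_poly \<phi> \<eta> n \<omega>) v) / real n)) \<longlonglongrightarrow> 1 / 2"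
proof -
  note circ = assms(1) and orth = assms(8) and P = assms(9) and iid = assms(10)
  note prob_cgauss = iid_cgauss(1)[OF P iid]
  let ?q = "\<lambda>n t. exceed_prob v (sqrt (kernel \<phi> n (cis t)))"
  have "(\<lambda>n. \<integral>t. ?q n t \<partial>unif_angle) \<longlonglongrightarrow> (\<integral>t. 1 \<partial>unif_angle)"
  proof (rule integral_dominated_convergence[where w = "\<lambda>_. 1"])
    show "AE t in unif_angle. (\<lambda>n. ?q n t) \<longlonglongrightarrow> 1"
    proof (rule AE_I2)
      fix t
      have "filterlim (\<lambda>n. kernel \<phi> n (cis t)) at_top sequentially"
        by (rule kernel_at_top[OF circ orth _ AE_lebesgue_arc_neq[OF circ assms(3)]]) simp
      hence "filterlim (\<lambda>n. sqrt (kernel \<phi> n (cis t))) at_top sequentially"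
        by (rule filterlim_compose[OF sqrt_at_top])
      thus "(\<lambda>n. ?q n t) \<longlonglongrightarrow> 1" by (rule exceed_prob_at_top[OF prob_cgauss])
    qed
    show "AE t in unif_angle. norm (?q n t) \<le> 1" for n
      using exceed_prob_bounds[OF prob_cgauss] by (intro AE_I2) simp
    show "?q n \<in> borel_measurable unif_angle" for n
      using measurable_compose[OF _ measurable_exceed_prob[OF circ orth P iid], of "\<lambda>t. sqrt (kernel \<phi> n (cis t))" unif_angle]
        measurable_kernel_cis[OF circ orth P iid, of n] by simp
  qed auto
  hence "(\<lambda>n. 1 / 2 * (\<integral>t. ?q n t \<partial>unif_angle)) \<longlonglongrightarrow> 1 / 2 * 1"
    by (intro tendsto_intros) (simp add: unif_angle.prob_space[simplified])
  moreover have "eventually (\<lambda>n. 1 / 2 * (\<integral>t. ?q n t \<partial>unif_angle)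
     = (\<integral>\<omega>. real (disk_roots (random_poly \<phi> \<eta> n \<omega>) v) / real n \<partial>P)) sequentially"
    using eventually_gt_at_top[of 0]
    by eventually_elim (simp add: expectation_disk_roots[OF circ orth P iid])
  ultimately show ?thesis by (auto intro: Lim_transform_eventually)
qed

end
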